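(* Let $\lambda>0$ and let $f\in\mathrm{BMO}(\mathbb{R}_+,dm_\lambda)$. Then $f\in\mathrm{CMO}(\mathbb{R}_+,dm_\lambda)$ if and only if $f$ satisfies the following three conditions (where $I$ ranges over intervals in $\mathbb{R}_+$): (i) $\displaystyle\lim_{a\to0^+}\ \sup_{m_\lambda(I)=a}M_\lambda(f,I)=0$; (ii) $\displaystyle\lim_{a\to\infty}\ \sup_{m_\lambda(I)=a}M_\lambda(f,I)=0$; (iii) $\displaystyle\lim_{R\to\infty}\ \sup_{I\subset[R,\infty)}M_\lambda(f,I)=0$.
   Context: $\mathbb{R}_+:=(0,\infty)$, $\lambda>0$ is fixed, $dm_\lambda(x):=x^{2\lambda}\,dx$, and $m_\lambda(E):=\int_E x^{2\lambda}\,dx$. For $x,r\in\mathbb{R}_+$, $I(x,r):=(x-r,x+r)\cap\mathbb{R}_+$; intervals $I$ are of this form. For $f\in L^1_{\rm loc}(\mathbb{R}_+,dm_\lambda)$ and an interval $I=I(x,r)$, put $f_{I,\lambda}:=\frac1{m_\lambda(I)}\int_I f(y)\,y^{2\lambda}\,dy$ and $M_\lambda(f,I):=\frac1{m_\lambda(I)}\int_I|f(y)-f_{I,\lambda}|\,y^{2\lambda}\,dy$. The space $\mathrm{BMO}(\mathbb{R}_+,dm_\lambda)$ consists of those $f$ with $\|f\|_{\mathrm{BMO}(\mathbb{R}_+,dm_\lambda)}:=\sup_{x,r\in(0,\infty)}M_\lambda(f,I(x,r))<\infty$. $\mathrm{CMO}(\mathbb{R}_+,dm_\lambda)$ is the closure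 in $\mathrm{BMO}(\mathbb{R}_+,dm_\lambda)$ of $\mathcal{D}$, the set of $C^\infty(\mathbb{R}_+)$ functions with compact supports. *)

theory Defs
  imports "HOL-Analysis.Analysis"
begin

text \<open>Functions on \<open>(0,\<infinity>)\<close> are represented by functions on \<^typ>\<open>real\<close>; every notion
  below depends only on their values on \<^term>\<open>{0::real<..}\<close>.\<close>

definition m_lam :: "real \<Rightarrow> real measure" where
  "m_lam lam = density (lebesgue_on {0<..}) (\<lambda>x. ennreal (x powr (2 * lam)))"

definition Ival :: "real \<Rightarrow> real \<Rightarrow> real set" where
  "Ival x r = {x - r<..<x + r} \<inter> {0<..}"

definition intervals :: "real set set" where
  "intervals = {Ival x r |x r. 0 < x \<and> 0 < r}"

definition L1_loc :: "real \<Rightarrow> (real \<Rightarrow> 'a::{banach, second_countable_topology}) set" where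
  "L1_loc lam = {f. \<forall>K. compact K \<and> K \<subseteq> {0<..} \<longrightarrow> set_integrable (m_lam lam) K f}"

definition avg :: "real \<Rightarrow> (real \<Rightarrow> 'a::{banach, second_countable_topology}) \<Rightarrow> real set \<Rightarrow> 'a" where
  "avg lam f I = (1 / measure (m_lam lam) I) *\<^sub>R (LINT y:I|m_lam lam. f y)"

text \<open>The mean oscillation takes values in \<^typ>\<open>ennreal\<close>. An interval \<open>(0,b)\<close> is not
  relatively compact in \<open>(0,\<infinity>)\<close>, so a function in \<open>L1_loc\<close> may fail to be integrable
  on it. Then the Bochner integral in \<open>avg\<close> is \<open>0\<close> and \<open>mean_osc\<close> is \<open>\<infinity>\<close>, so that
  finiteness of the BMO seminorm forces integrability on every interval.\<close>

definition mean_osc ::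
    "real \<Rightarrow> (real \<Rightarrow> 'a::{banach, second_countable_topology}) \<Rightarrow> real set \<Rightarrow> ennreal" where
  "mean_osc lam f I =
     (\<integral>\<^sup>+y\<in>I. ennreal (norm (f y - avg lam f I)) \<partial>m_lam lam) / emeasure (m_lam lam) I"

definition BMO_norm ::
    "real \<Rightarrow> (real \<Rightarrow> 'a::{banach, second_countable_topology}) \<Rightarrow> ennreal" where
  "BMO_norm lam f = (SUP I\<in>intervals. mean_osc lam f I)"

definition BMO :: "real \<Rightarrow> (real \<Rightarrow> 'a::{banach, second_countable_topology}) set" where
  "BMO lam = {f \<in> L1_loc lam. BMO_norm lam f < \<infinity>}"

text \<open>\<open>C\<^sup>\<infinity>\<close> on \<open>(0,\<infinity>)\<close>: all iterated derivatives exist there. The support is taken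
  relative to \<open>(0,\<infinity>)\<close>, so a function in \<open>test_functions\<close> vanishes near \<open>0\<close>.\<close>

definition smooth_pos :: "(real \<Rightarrow> 'a::real_normed_vector) \<Rightarrow> bool" where
  "smooth_pos \<phi> \<longleftrightarrow>
     (\<forall>n. \<forall>x>0. ((\<lambda>g t. vector_derivative g (at t)) ^^ n) \<phi> differentiable (at x))"

definition test_functions :: "(real \<Rightarrow> 'a::real_normed_vector) set" where
  "test_functions =
     {\<phi>. smooth_pos \<phi> \<and> compact ({0<..} \<inter> closure {x. 0 < x \<and> \<phi> x \<noteq> 0})}"

definition CMO :: "real \<Rightarrow> (real \<Rightarrow> 'a::{banach, second_countable_topology}) set" where
  "CMO lam = {f \<in> BMO lam. \<forall>\<epsilon>>0. \<exists>\<phi>\<in>test_functions. BMO_norm lam (\<lambda>x. f x - \<phi> x) < ennreal \<epsilon>}"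

end

theory Submission
  imports Defs
begin

text \<open>In the coordinate \<open>u = x^(2\<lambda>+1) / (2\<lambda>+1)\<close> the measure \<open>m\<^sub>\<lambda>\<close> is Lebesgue measure on
  \<open>(0,\<infinity>)\<close> and the intervals \<open>I(x,r)\<close> are all bounded intervals \<open>(u,v)\<close> with
  \<open>0 \<le> u < v\<close>. A test function satisfies the three conditions, and they are stable under
  limits in BMO. Conversely, let \<open>f\<close> satisfy them and write \<open>e\<close> for the resulting bound on the
  oscillation over short, long and far intervals.
  Replace \<open>f\<close> by \<open>g(u)\<close>, its average over \<open>(u, u + \<rho>(u))\<close>, where \<open>\<rho>\<close> is a small constant at first
  and grows like \<open>u\<close> at infinity. Then \<open>f - g\<close> has small oscillation and \<open>g\<close> varies
  by at most \<open>6e\<close> on \<open>[u, u + \<rho>(u)]\<close>. Hence \<open>g\<close> may be frozen at its value at some large \<open>A\<close>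
  beyond \<open>A\<close>, and made constant near \<open>0\<close>. The two constants differ in general; a
  logarithmic cutoff near \<open>0\<close>, whose BMO norm can be made arbitrarily small, removes the
  difference. What remains is continuous with compact support up to a constant, so it is a uniform
  limit of test functions.\<close>

section \<open>Integration against the weighted measure\<close>

lemma sets_m_lam: "sets (m_lam lam) = sets (lebesgue_on {0<..})"
  and space_m_lam: "space (m_lam lam) = {0<..}"
  by (simp_all add: m_lam_def)

lemma borel_subset_sets_m_lam: "A \<in> sets borel \<Longrightarrow> A \<subseteq> {0<..} \<Longrightarrow> A \<in> sets (m_lam lam)"
  by (auto simp: sets_m_lam sets_restrict_space_iff)

text \<open>The density moves onto the integrand, and the fundamental theorem of calculus does the
  rest. Differentiability is asked for only inside the interval because \<open>W\<close> may blow up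
  at \<open>a = 0\<close>, as it does in \<open>nn_integral_sqrt_J\<close>.\<close>

lemma nn_integral_m_lam:
  fixes W :: "real \<Rightarrow> real"
  assumes [measurable]: "W \<in> borel_measurable borel"
    and ab: "0 \<le> a" "a \<le> b"
    and W: "\<And>x. a < x \<Longrightarrow> x < b \<Longrightarrow> 0 \<le> W x"
    and H: "continuous_on {a..b} H"
    and H': "\<And>x. a < x \<Longrightarrow> x < b \<Longrightarrow> (H has_real_derivative W x * x powr (2 * lam)) (at x)"
  shows "(\<integral>\<^sup>+x\<in>{a<..<b}. ennreal (W x) \<partial>m_lam lam) = ennreal (H b - H a)"
proof -
  have W_meas: "(\<lambda>x. ennreal (W x) * indicator {a<..<b} x) \<in> borel_measurable (lebesgue_on {0<..})"
    by (rule measurable_restrict_space1, rule measurable_completion) simp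
  have "((\<lambda>x. W x * x powr (2 * lam)) has_integral (H b - H a)) {a..b}"
    using ab H H' by (intro fundamental_theorem_of_calculus_interior)
      (auto simp: has_real_derivative_iff_has_vector_derivative)
  then have "((\<lambda>x. W x * x powr (2 * lam)) has_integral (H b - H a)) {a<..<b}"
    by (simp add: has_integral_Icc_iff_Ioo)
  then have "(\<integral>\<^sup>+x. ennreal (W x * x powr (2 * lam)) * indicator {a<..<b} x \<partial>lborel) = ennreal (H b - H a)"
    using W by (intro nn_integral_has_integral_lebesgue') auto
  moreover have "(\<integral>\<^sup>+x\<in>{a<..<b}. ennreal (W x) \<partial>m_lam lam) =
     (\<integral>\<^sup>+x. ennreal (x powr (2 * lam)) * (ennreal (W x) * indicator {a<..<b} x) \<partial>lebesgue_on {0<..})"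
    unfolding m_lam_def using W_meas
    by (subst nn_integral_density) (auto intro!: measurable_restrict_space1 measurable_completion)
  moreover have "\<dots> = (\<integral>\<^sup>+x. ennreal (x powr (2 * lam)) * (ennreal (W x) * indicator {a<..<b} x) * indicator {0<..} x \<partial>lebesgue)"
    by (subst nn_integral_restrict_space) auto
  moreover have "\<dots> = (\<integral>\<^sup>+x. ennreal (W x * x powr (2 * lam)) * indicator {a<..<b} x \<partial>lborel)"
    unfolding nn_integral_completion using ab W
    by (intro nn_integral_cong) (auto simp: indicator_def ennreal_mult mult_ac)
  ultimately show ?thesis by simp
qed

section \<open>The mass coordinate and the intervals\<close>

locale half_line =
  fixes lam :: real
  assumes lam: "lam > 0"
begin

abbreviation M where "M \<equiv> m_lam lam"

text \<open>For \<open>x > 0\<close> this is the mass of (0, x); \<open>G\<close> is its inverse on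
  the closed half line.\<close>

definition F :: "real \<Rightarrow> real" where "F x = x powr (2 * lam + 1) / (2 * lam + 1)"
definition G :: "real \<Rightarrow> real" where "G u = ((2 * lam + 1) * u) powr (1 / (2 * lam + 1))"

text \<open>\<open>J u v\<close> is the interval \<open>(u, v)\<close> of the coordinate \<open>F x\<close>.\<close>

definition J :: "real \<Rightarrow> real \<Rightarrow> real set" where "J u v = {G u<..<G v}"

lemma F_G [simp]: "0 \<le> u \<Longrightarrow> F (G u) = u"
  using lam by (simp add: F_def G_def powr_powr)

lemma G_F [simp]: "0 \<le> x \<Longrightarrow> G (F x) = x"
  using lam by (simp add: F_def G_def powr_powr)

lemma F_strict_mono: "0 \<le> x \<Longrightarrow> x < y \<Longrightarrow> F x < F y"
  using lam by (auto simp: F_def intro!: divide_strict_right_mono powr_less_mono2)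

lemma F_nonneg [simp]: "0 \<le> F x"
  using lam by (simp add: F_def)

lemma F_pos: "0 < x \<Longrightarrow> 0 < F x"
  using lam by (simp add: F_def)

lemma F_0 [simp]: "F 0 = 0" and G_0 [simp]: "G 0 = 0"
  using lam by (simp_all add: F_def G_def)

lemma G_strict_mono: "0 \<le> x \<Longrightarrow> x < y \<Longrightarrow> G x < G y"
  using lam by (auto simp: G_def intro!: powr_less_mono2)

lemma G_nonneg [simp]: "0 \<le> G x"
  using lam by (simp add: G_def)

lemma G_less_iff: "0 \<le> x \<Longrightarrow> 0 \<le> y \<Longrightarrow> G x < G y \<longleftrightarrow> x < y"
  using G_strict_mono[of x y] G_strict_mono[of y x] by (cases x y rule: linorder_cases) auto

lemma F_less_iff: "0 \<le> x \<Longrightarrow> 0 \<le> y \<Longrightarrow> F x < F y \<longleftrightarrow> x < y"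
  using F_strict_mono[of x y] F_strict_mono[of y x] by (cases x y rule: linorder_cases) auto

lemma G_le_iff: "0 \<le> x \<Longrightarrow> 0 \<le> y \<Longrightarrow> G x \<le> G y \<longleftrightarrow> x \<le> y"
  using G_less_iff[of y x] by (simp flip: not_less)

lemma mem_J_iff:
  assumes "0 \<le> u" "0 \<le> v" shows "x \<in> J u v \<longleftrightarrow> 0 < x \<and> u < F x \<and> F x < v"
proof -
  have *: "0 < x" if "G u < x" using that G_nonneg[of u] by linarith
  have "x \<in> J u v \<longleftrightarrow> 0 < x \<and> G u < G (F x) \<and> G (F x) < G v"
    using * by (auto simp: J_def)
  then show ?thesis using assms by (auto simp: G_less_iff)
qed

lemma continuous_on_F: "continuous_on {0..} F"
  unfolding F_def using lam by (intro continuous_intros continuous_on_powr') auto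

lemma continuous_on_F_Icc: "continuous_on {G u..b} F"
  by (rule continuous_on_subset[OF continuous_on_F]) (auto intro: order_trans[OF G_nonneg])

lemma measurable_F [measurable]: "F \<in> borel_measurable borel"
  unfolding F_def by measurable

lemma DERIV_F:
  assumes "0 < x" shows "(F has_real_derivative x powr (2 * lam)) (at x)"
proof -
  have "(F has_real_derivative (2 * lam + 1) * x powr (2 * lam + 1 - 1) / (2 * lam + 1)) (at x)"
    unfolding F_def using assms by (intro DERIV_cdivide has_real_derivative_powr)
  then show ?thesis using lam by (simp add: add_nonneg_eq_0_iff)
qed

text \<open>Clipping at 0 only moves a negative left end to 0. Conversely, an interval with
  nonnegative ends is given by its midpoint and half its length, and is then not clipped at
  all.\<close>

lemma intervals_eq: "intervals = {J u v |u v. 0 \<le> u \<and> u < v}"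
proof (intro set_eqI iffI)
  fix I assume "I \<in> intervals"
  then obtain x r where I: "I = Ival x r" "0 < x" "0 < r" by (auto simp: intervals_def)
  have "I = J (F (max 0 (x - r))) (F (x + r))"
    using I by (auto simp: Ival_def J_def)
  moreover have "F (max 0 (x - r)) < F (x + r)"
    using I by (intro F_strict_mono) auto
  ultimately show "I \<in> {J u v |u v. 0 \<le> u \<and> u < v}" using F_nonneg by blast
next
  fix I assume "I \<in> {J u v |u v. 0 \<le> u \<and> u < v}"
  then obtain u v where uv: "I = J u v" "0 \<le> u" "u < v" by blast
  have G: "0 \<le> G u" "G u < G v" using uv by (auto intro: G_strict_mono)
  have "I = Ival ((G u + G v) / 2) ((G v - G u) / 2)"
    using uv G by (auto simp: J_def Ival_def field_simps intro: le_less_trans[OF G_nonneg])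
  moreover have "0 < (G u + G v) / 2"
    using add_nonneg_pos[OF G(1) le_less_trans[OF G]] by simp
  moreover have "0 < (G v - G u) / 2" using G(2) by simp
  ultimately show "I \<in> intervals" unfolding intervals_def by blast
qed

lemma J_sets [measurable, simp]: "J u v \<in> sets M"
  by (intro borel_subset_sets_m_lam) (auto simp: J_def intro: le_less_trans[OF G_nonneg])

lemma emeasure_J: assumes "0 \<le> u" "u \<le> v" shows "emeasure M (J u v) = ennreal (v - u)"
proof -
  have "emeasure M (J u v) = (\<integral>\<^sup>+x\<in>{G u<..<G v}. ennreal 1 \<partial>M)"
    using J_sets[of u v] by (simp add: J_def)
  also have "\<dots> = ennreal (F (G v) - F (G u))"
  proof (rule nn_integral_m_lam)
    show "(F has_real_derivative 1 * x powr (2 * lam)) (at x)" if "G u < x" for x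
      using DERIV_F[of x] that G_nonneg[of u] by (simp add: le_less_trans)
  qed (use assms in \<open>auto simp: G_le_iff intro: continuous_on_F_Icc\<close>)
  finally show ?thesis using assms by simp
qed

lemma measure_J: "0 \<le> u \<Longrightarrow> u \<le> v \<Longrightarrow> measure M (J u v) = v - u"
  by (simp add: measure_def emeasure_J)

text \<open>In the coordinate y = \<open>F x\<close> the primitive of sqrt(v/y) is 2 sqrt(v y), and
  \<open>u\<close> is at most sqrt(u v). The average of sqrt(v/y) is thus at most 2 on every
  interval, even if it touches 0; this controls the logarithmic cutoff.\<close>

lemma nn_integral_sqrt_J:
  assumes "0 \<le> u" "u < v"
  shows "(\<integral>\<^sup>+x\<in>J u v. ennreal (sqrt (v / F x)) \<partial>M) \<le> ennreal (2 * (v - u))"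
proof -
  have "(\<integral>\<^sup>+x\<in>{G u<..<G v}. ennreal (sqrt (v / F x)) \<partial>M) =
      ennreal (2 * sqrt v * sqrt (F (G v)) - 2 * sqrt v * sqrt (F (G u)))"
  proof (rule nn_integral_m_lam[where H = "\<lambda>x. 2 * sqrt v * sqrt (F x)"])
    show "((\<lambda>x. 2 * sqrt v * sqrt (F x)) has_real_derivative sqrt (v / F x) * x powr (2 * lam)) (at x)"
      if "G u < x" for x
    proof -
      have x: "0 < x" using that G_nonneg[of u] by linarith
      then have "((\<lambda>x. 2 * sqrt v * sqrt (F x)) has_real_derivative
          2 * sqrt v * (x powr (2 * lam) * (inverse (sqrt (F x)) / 2))) (at x)"
        using F_pos[of x] by (auto intro!: derivative_eq_intros DERIV_F)
      then show ?thesis by (simp add: real_sqrt_divide field_simps)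
    qed
  qed (use assms in \<open>auto simp: G_le_iff intro!: continuous_intros continuous_on_F_Icc\<close>)
  also have "\<dots> \<le> ennreal (2 * (v - u))"
  proof (rule ennreal_leI)
    have "u = sqrt u * sqrt u" using assms by simp
    also have "\<dots> \<le> sqrt v * sqrt u" using assms by (intro mult_right_mono) auto
    finally have "u \<le> sqrt v * sqrt u" .
    moreover have "sqrt v * sqrt v = v" using assms by simp
    ultimately show "2 * sqrt v * sqrt (F (G v)) - 2 * sqrt v * sqrt (F (G u)) \<le> 2 * (v - u)"
      using assms by (simp add: mult.assoc)
  qed
  finally show ?thesis by (simp add: J_def)
qed


section \<open>Integrability up to the endpoint 0 and L1 norms over intervals\<close>

definition loc_integrable :: "(real \<Rightarrow> 'a::euclidean_space) \<Rightarrow> bool" where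
  "loc_integrable f \<longleftrightarrow> (\<forall>v\<ge>0. set_integrable M (J 0 v) f)"

text \<open>Not divided by the length, so that it is additive over adjacent intervals and monotone
  in the interval.\<close>

definition N :: "(real \<Rightarrow> 'a::euclidean_space) \<Rightarrow> real \<Rightarrow> real \<Rightarrow> real" where
  "N f u v = (LINT x:J u v|M. norm (f x))"

lemma J_mono: "0 \<le> u \<Longrightarrow> u \<le> u' \<Longrightarrow> 0 \<le> v' \<Longrightarrow> v' \<le> v \<Longrightarrow> J u' v' \<subseteq> J u v"
  by (auto simp: mem_J_iff)

lemma loc_integrableD: "loc_integrable f \<Longrightarrow> 0 \<le> u \<Longrightarrow> u \<le> v \<Longrightarrow> set_integrable M (J u v) f"
  unfolding loc_integrable_def
  by (rule set_integrable_subset[of M "J 0 v"]) (use J_mono[of 0 u v v] in auto)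

lemma loc_integrable_normD:
  "loc_integrable f \<Longrightarrow> 0 \<le> u \<Longrightarrow> u \<le> v \<Longrightarrow> set_integrable M (J u v) (\<lambda>x. norm (f x))"
  by (rule set_integrable_norm) (rule loc_integrableD)

lemma set_integrable_const_J: "0 \<le> u \<Longrightarrow> u \<le> v \<Longrightarrow> set_integrable M (J u v) (\<lambda>x. c :: 'a::euclidean_space)"
  unfolding set_integrable_def using emeasure_J[of u v] by (intro integrable_scaleR_left) auto

lemma loc_integrable_const [simp, intro]: "loc_integrable (\<lambda>x. c)"
  by (simp add: loc_integrable_def set_integrable_const_J)

lemma loc_integrable_add [intro]: "loc_integrable f \<Longrightarrow> loc_integrable g \<Longrightarrow> loc_integrable (\<lambda>x. f x + g x)"
  and loc_integrable_diff [intro]: "loc_integrable f \<Longrightarrow> loc_integrable g \<Longrightarrow> loc_integrable (\<lambda>x. f x - g x)"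
  by (auto simp: loc_integrable_def)

lemma borel_measurable_m_lam_continuous:
  assumes "continuous_on {0<..} (f :: real \<Rightarrow> 'a::euclidean_space)"
  shows "f \<in> borel_measurable M"
proof -
  have "f \<in> borel_measurable (restrict_space borel {0<..})"
    using assms by (rule borel_measurable_continuous_on_restrict)
  then have "(\<lambda>x. indicator {0<..} x *\<^sub>R f x) \<in> borel_measurable borel"
    by (subst (asm) borel_measurable_restrict_space_iff) auto
  then have "(\<lambda>x. indicator {0<..} x *\<^sub>R f x) \<in> borel_measurable lebesgue"
    by (intro measurable_completion) simp
  then have "f \<in> borel_measurable (lebesgue_on {0<..})"
    by (subst borel_measurable_restrict_space_iff) auto
  then show ?thesis by (simp add: m_lam_def)
qed

lemma loc_integrable_bounded:
  assumes f: "continuous_on {0<..} f"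
    and B: "\<And>v. 0 < v \<Longrightarrow> \<exists>B. \<forall>x\<in>J 0 v. norm (f x) \<le> B"
  shows "loc_integrable f"
  unfolding loc_integrable_def
proof (intro allI impI)
  fix v :: real assume v: "0 \<le> v"
  show "set_integrable M (J 0 v) f"
  proof (cases "v = 0")
    case True
    then show ?thesis by (simp add: J_def)
  next
    case False
    then obtain B where B: "\<And>x. x \<in> J 0 v \<Longrightarrow> norm (f x) \<le> B" using B[of v] v by auto
    have [measurable]: "f \<in> borel_measurable M" using f by (rule borel_measurable_m_lam_continuous)
    show ?thesis
    proof (rule set_integrable_bound)
      show "set_integrable M (J 0 v) (\<lambda>x. B)" using v by (rule set_integrable_const_J[OF order_refl])
      show "set_borel_measurable M (J 0 v) f" unfolding set_borel_measurable_def by measurable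
      show "AE x in M. x \<in> J 0 v \<longrightarrow> norm (f x) \<le> norm B"
        using B by (intro AE_I2 impI) force
    qed
  qed
qed

lemma loc_integrable_comp_F:
  assumes "continuous_on {0..} g" shows "loc_integrable (\<lambda>x. g (F x))"
proof (rule loc_integrable_bounded)
  show "continuous_on {0<..} (\<lambda>x. g (F x))"
    by (rule continuous_on_compose2[OF assms continuous_on_subset[OF continuous_on_F]]) auto
  fix v :: real assume v: "0 < v"
  have "bounded (g ` {0..v})"
    by (intro compact_imp_bounded compact_continuous_image continuous_on_subset[OF assms]) auto
  then obtain B where "\<And>u. u \<in> {0..v} \<Longrightarrow> norm (g u) \<le> B" unfolding bounded_iff by blast
  then show "\<exists>B. \<forall>x\<in>J 0 v. norm (g (F x)) \<le> B"
    using v by (intro exI[of _ B]) (auto simp: mem_J_iff)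
qed

lemma N_nonneg [simp]: "0 \<le> N f u v"
  unfolding N_def set_lebesgue_integral_def by (intro integral_nonneg_AE) auto

lemma N_mono:
  assumes "loc_integrable f" "loc_integrable g" "0 \<le> u" "u \<le> v"
    and "\<And>x. x \<in> J u v \<Longrightarrow> norm (f x) \<le> norm (g x)"
  shows "N f u v \<le> N g u v"
  unfolding N_def using assms by (intro set_integral_mono loc_integrable_normD)

lemma N_const: "0 \<le> u \<Longrightarrow> u \<le> v \<Longrightarrow> N (\<lambda>x. c) u v = norm c * (v - u)"
  unfolding N_def set_lebesgue_integral_def by (simp add: measure_J emeasure_J)

lemma N_le_bound:
  assumes "loc_integrable f" "0 \<le> u" "u \<le> v" "\<And>x. x \<in> J u v \<Longrightarrow> norm (f x) \<le> C" "0 \<le> C"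
  shows "N f u v \<le> C * (v - u)"
proof -
  have "N f u v \<le> N (\<lambda>x. C) u v" by (rule N_mono) (use assms in auto)
  then show ?thesis using assms by (simp add: N_const)
qed

lemma N_triangle:
  assumes "loc_integrable f" "loc_integrable g" "0 \<le> u" "u \<le> v"
  shows "N (\<lambda>x. f x + g x) u v \<le> N f u v + N g u v"
proof -
  have "N (\<lambda>x. f x + g x) u v \<le> (LINT x:J u v|M. norm (f x) + norm (g x))"
    unfolding N_def using assms
    by (intro set_integral_mono loc_integrable_normD set_integral_add loc_integrable_add norm_triangle_ineq)
  also have "\<dots> = N f u v + N g u v"
    unfolding N_def using assms by (intro set_integral_add loc_integrable_normD)
  finally show ?thesis .
qed

lemma N_cong: "0 \<le> u \<Longrightarrow> 0 \<le> v \<Longrightarrow> (\<And>x. x \<in> J u v \<Longrightarrow> norm (f x) = norm (g x)) \<Longrightarrow> N f u v = N g u v"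
  unfolding N_def set_lebesgue_integral_def by (intro Bochner_Integration.integral_cong) (auto simp: indicator_def)

lemma N_minus: "N (\<lambda>x. f x - g x) u v = N (\<lambda>x. g x - f x) u v"
  by (simp add: N_def norm_minus_commute)

lemma N_triangle_diff:
  assumes "loc_integrable f" "loc_integrable g" "loc_integrable h" "0 \<le> u" "u \<le> v"
  shows "N (\<lambda>x. f x - h x) u v \<le> N (\<lambda>x. f x - g x) u v + N (\<lambda>x. g x - h x) u v"
  using N_triangle[of "\<lambda>x. f x - g x" "\<lambda>x. g x - h x" u v] assms by auto

text \<open>The point has neighbourhoods of arbitrarily small mass. This allows an open interval to
  be cut at an inner point.\<close>

lemma AE_neq_point: "0 < w \<Longrightarrow> AE x in M. x \<noteq> w"
proof -
  assume w: "0 < w"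
  have "{w} \<in> null_sets M"
  proof -
    have "{w} \<in> sets M" by (rule borel_subset_sets_m_lam) (use w in auto)
    moreover have "emeasure M {w} \<le> ennreal e" if e: "e > 0" for e
    proof -
      \<comment> \<open>The minimum keeps the left end \<open>F w - d / 2\<close> positive.\<close>
      define d where "d = min e (F w)"
      have d: "0 < d" "d \<le> e" "d \<le> F w" using e F_pos[OF w] by (auto simp: d_def)
      have "emeasure M {w} \<le> emeasure M (J (F w - d / 2) (F w + d / 2))"
        using d w by (intro emeasure_mono) (auto simp: mem_J_iff)
      also have "\<dots> = ennreal d"
        using d by (subst emeasure_J) auto
      also have "\<dots> \<le> ennreal e" using d by (intro ennreal_leI)
      finally show ?thesis .
    qed
    then have "emeasure M {w} \<le> 0" using ennreal_le_epsilon[of 0 "emeasure M {w}"] by simp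
    ultimately show ?thesis by (auto simp: null_sets_def)
  qed
  from AE_not_in[OF this] show ?thesis by simp
qed

lemma integral_split:
  fixes f :: "real \<Rightarrow> 'b::euclidean_space"
  assumes f: "set_integrable M (J u v) f" and u: "0 \<le> u" "u \<le> w" "w \<le> v"
  shows "(LINT x:J u v|M. f x) = (LINT x:J u w|M. f x) + (LINT x:J w v|M. f x)"
\<comment> \<open>This case is kept apart because the cut may then be at 0, to which
  \<open>AE_neq_point\<close> does not apply.\<close>
proof (cases "u = w")
  case True
  then show ?thesis by (simp add: J_def set_lebesgue_integral_def)
next
  case False
  then have w: "0 < w" "0 < G w" using u G_strict_mono[of 0 w] by auto
  have sub: "J u w \<subseteq> J u v" "J w v \<subseteq> J u v" using u by (simp_all add: J_mono)
  have i: "set_integrable M (J u w) f" "set_integrable M (J w v) f"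
    using f sub by (auto intro: set_integrable_subset)
  have "(LINT x:J u v|M. f x) = (LINT x:J u w \<union> J w v|M. f x)"
  proof (rule set_integral_cong_set)
    show "set_borel_measurable M (J u w \<union> J w v) f"
      using set_integrable_Un[OF i] by (auto simp: set_borel_measurable_def set_integrable_def)
    show "set_borel_measurable M (J u v) f"
      using f by (auto simp: set_borel_measurable_def set_integrable_def)
    show "AE x in M. x \<in> J u w \<union> J w v \<longleftrightarrow> x \<in> J u v"
      using AE_neq_point[OF w(2)]
    proof eventually_elim
      case (elim x)
      have "F x \<noteq> w" if "0 < x" using elim that by force
      then show ?case using u w by (auto simp: mem_J_iff)
    qed
  qed
  also have "\<dots> = (LINT x:J u w|M. f x) + (LINT x:J w v|M. f x)"
    using i u w by (intro set_integral_Un) (auto simp: mem_J_iff)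
  finally show ?thesis .
qed

lemma N_split:
  assumes "loc_integrable f" "0 \<le> u" "u \<le> w" "w \<le> v"
  shows "N f u v = N f u w + N f w v"
  unfolding N_def using assms by (intro integral_split loc_integrable_normD) auto

lemma N_mono_interval:
  assumes "loc_integrable f" "0 \<le> u" "u \<le> u'" "u' \<le> v'" "v' \<le> v"
  shows "N f u' v' \<le> N f u v"
  using N_split[of f u u' v] N_split[of f u' v' v] N_nonneg[of f u u'] N_nonneg[of f v' v] assms by linarith

section \<open>Averages and mean oscillation\<close>

lemma avg_J: "0 \<le> u \<Longrightarrow> u \<le> v \<Longrightarrow> avg lam f (J u v) = (1 / (v - u)) *\<^sub>R (LINT x:J u v|M. f x)"
  by (simp add: avg_def measure_J)

text \<open>Averaging commutes with subtracting a constant, so this is the triangle inequality for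
  the integral of \<open>f x - c\<close>.\<close>

lemma norm_avg_diff_le:
  assumes f: "loc_integrable f" and u: "0 \<le> u" "u < v"
  shows "(v - u) * norm (avg lam f (J u v) - c) \<le> N (\<lambda>x. f x - c) u v"
proof -
  have "(v - u) * norm (avg lam f (J u v) - c) = norm ((v - u) *\<^sub>R (avg lam f (J u v) - c))"
    using u by simp
  also have "(v - u) *\<^sub>R (avg lam f (J u v) - c) = (LINT x:J u v|M. f x) - (LINT x:J u v|M. c)"
    using u by (simp add: avg_J scaleR_diff_right set_lebesgue_integral_def measure_J emeasure_J)
  also have "\<dots> = (LINT x:J u v|M. f x - c)"
    using f u by (intro set_integral_diff(2)[symmetric] loc_integrableD set_integrable_const_J) auto
  also have "norm \<dots> \<le> N (\<lambda>x. f x - c) u v"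
    unfolding N_def using f u by (intro set_integral_norm_bound loc_integrableD loc_integrable_diff) auto
  finally show ?thesis .
qed

text \<open>The constant is free instead of being the average, which makes the notion subadditive
  without computing averages. It agrees with \<open>mean_osc\<close> up to a factor 2.\<close>

definition osc_le :: "(real \<Rightarrow> 'a::euclidean_space) \<Rightarrow> real \<Rightarrow> real \<Rightarrow> real \<Rightarrow> bool" where
  "osc_le f C u v \<longleftrightarrow> (\<exists>c. N (\<lambda>x. f x - c) u v \<le> C * (v - u))"

lemma osc_leI: "N (\<lambda>x. f x - c) u v \<le> C * (v - u) \<Longrightarrow> osc_le f C u v"
  by (auto simp: osc_le_def)

lemma osc_le_add:
  assumes "osc_le f C u v" "osc_le g D u v" "loc_integrable f" "loc_integrable g" "0 \<le> u" "u \<le> v"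
  shows "osc_le (\<lambda>x. f x + g x) (C + D) u v"
proof -
  obtain c d where cd: "N (\<lambda>x. f x - c) u v \<le> C * (v - u)" "N (\<lambda>x. g x - d) u v \<le> D * (v - u)"
    using assms by (auto simp: osc_le_def)
  have "N (\<lambda>x. (f x - c) + (g x - d)) u v \<le> N (\<lambda>x. f x - c) u v + N (\<lambda>x. g x - d) u v"
    using assms by (intro N_triangle) auto
  then have "N (\<lambda>x. f x + g x - (c + d)) u v \<le> (C + D) * (v - u)"
    using cd by (simp add: algebra_simps)
  then show ?thesis by (rule osc_leI)
qed

lemma osc_le_minus: "osc_le f C u v \<Longrightarrow> osc_le (\<lambda>x. - f x) C u v"
proof -
  assume "osc_le f C u v"
  then obtain c where "N (\<lambda>x. f x - c) u v \<le> C * (v - u)" by (auto simp: osc_le_def)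
  then show ?thesis
    by (intro osc_leI[of _ "- c"]) (simp add: N_def norm_minus_commute)
qed

lemma osc_le_diff:
  assumes "osc_le f C u v" "osc_le g D u v" "loc_integrable f" "loc_integrable g" "0 \<le> u" "u \<le> v"
  shows "osc_le (\<lambda>x. f x - g x) (C + D) u v"
  using osc_le_add[OF assms(1) osc_le_minus[OF assms(2)]] loc_integrable_diff[OF loc_integrable_const[of 0] assms(4)]
    assms by simp

lemma osc_le_bounded:
  assumes "loc_integrable f" "0 \<le> u" "u \<le> v" "\<And>x. x \<in> J u v \<Longrightarrow> norm (f x - c) \<le> C" "0 \<le> C"
  shows "osc_le f C u v"
  using assms by (intro osc_leI[of _ c] N_le_bound) auto

lemma mean_osc_J:
  assumes f: "loc_integrable f" and u: "0 \<le> u" "u < v"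
  shows "mean_osc lam f (J u v) = ennreal (N (\<lambda>x. f x - avg lam f (J u v)) u v / (v - u))"
proof -
  let ?c = "avg lam f (J u v)"
  have i: "set_integrable M (J u v) (\<lambda>x. norm (f x - ?c))"
    using f u by (intro loc_integrable_normD) auto
  have "(\<integral>\<^sup>+x\<in>J u v. ennreal (norm (f x - ?c)) \<partial>M) = ennreal (N (\<lambda>x. f x - ?c) u v)"
    using nn_integral_eq_integral[OF i[unfolded set_integrable_def]]
    by (simp add: N_def set_lebesgue_integral_def indicator_mult_ennreal mult.commute)
  then show ?thesis
    using u by (simp add: mean_osc_def emeasure_J divide_ennreal)
qed

lemma mean_osc_le_imp:
  assumes f: "loc_integrable f" and u: "0 \<le> u" "u < v" and le: "mean_osc lam f (J u v) \<le> ennreal C" "0 \<le> C"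
  shows "N (\<lambda>x. f x - avg lam f (J u v)) u v \<le> C * (v - u)"
  using le u by (simp add: mean_osc_J[OF f u] ennreal_le_iff divide_simps)

lemma mean_osc_le_osc_le:
  assumes "loc_integrable f" "0 \<le> u" "u < v" "mean_osc lam f (J u v) \<le> ennreal C" "0 \<le> C"
  shows "osc_le f C u v"
  using mean_osc_le_imp[OF assms] by (rule osc_leI)

text \<open>Passing from \<open>c\<close> to the average costs their distance, which is itself at
  most the mean of \<open>norm (f x - c)\<close>; hence the factor 2.\<close>

lemma osc_le_mean_osc_le:
  assumes f: "loc_integrable f" and u: "0 \<le> u" "u < v" and le: "osc_le f C u v"
  shows "mean_osc lam f (J u v) \<le> ennreal (2 * C)"
proof -
  obtain c where c: "N (\<lambda>x. f x - c) u v \<le> C * (v - u)" using le by (auto simp: osc_le_def)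
  let ?a = "avg lam f (J u v)"
  have "N (\<lambda>x. f x - ?a) u v \<le> N (\<lambda>x. f x - c) u v + N (\<lambda>x. c - ?a) u v"
    using f u by (intro N_triangle_diff) auto
  also have "N (\<lambda>x. c - ?a) u v = (v - u) * norm (?a - c)"
    using u by (simp add: N_const norm_minus_commute)
  also have "\<dots> \<le> N (\<lambda>x. f x - c) u v" using f u by (rule norm_avg_diff_le)
  finally have "N (\<lambda>x. f x - ?a) u v \<le> 2 * C * (v - u)" using c by simp
  then show ?thesis using u unfolding mean_osc_J[OF f u]
    by (intro ennreal_leI) (simp add: divide_simps)
qed

text \<open>\<open>L1_loc\<close> controls \<open>f\<close> only on compact sets away from 0. They
  exhaust the half line and give measurability; integrability up to 0 comes from the finite
  oscillation on \<open>J 0 v\<close>, a set of finite mass.\<close>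

lemma loc_integrable_of_BMO:
  assumes f: "f \<in> BMO lam"
  shows "loc_integrable f"
  unfolding loc_integrable_def
proof (intro allI impI)
  fix v :: real assume v0: "0 \<le> v"
  show "set_integrable M (J 0 v) f"
  proof (cases "v = 0")
    case True
    then show ?thesis by (simp add: J_def)
  next
    case False
    then have v: "0 < v" using v0 by simp
    have loc: "set_integrable M {1 / real (Suc n)..real n} f" for n
    proof -
      have "{1 / real (Suc n)..real n} \<subseteq> {0<..}"
        by (auto intro: less_le_trans[rotated])
      then show ?thesis using f by (auto simp: BMO_def L1_loc_def)
    qed
    have [measurable]: "f \<in> borel_measurable M"
    proof (rule borel_measurable_LIMSEQ_metric)
      show "(\<lambda>x. indicator {1 / real (Suc n)..real n} x *\<^sub>R f x) \<in> borel_measurable M" for n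
        using loc[of n] by (auto simp: set_integrable_def)
      fix x assume "x \<in> space M"
      then have x: "0 < x" by (simp add: space_m_lam)
      have "eventually (\<lambda>n. x \<le> real n) sequentially"
        using filterlim_real_sequentially unfolding filterlim_at_top by blast
      moreover have "eventually (\<lambda>n. 1 / real (Suc n) < x) sequentially"
        using x by (intro order_tendstoD(2)[OF LIMSEQ_Suc[OF lim_1_over_n]])
      ultimately have "eventually (\<lambda>n. indicator {1 / real (Suc n)..real n} x *\<^sub>R f x = f x) sequentially"
        by eventually_elim auto
      then show "(\<lambda>n. indicator {1 / real (Suc n)..real n} x *\<^sub>R f x) \<longlonglongrightarrow> f x"
        by (rule tendsto_eventually)
    qed
    \<comment> \<open>At this point \<open>?c\<close> might still be the default value of a
      divergent integral. The argument uses only that it is some constant.\<close>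
    let ?c = "avg lam f (J 0 v)"
    have "J 0 v \<in> intervals" using v by (auto simp: intervals_eq)
    then have "mean_osc lam f (J 0 v) \<le> BMO_norm lam f" unfolding BMO_norm_def by (rule SUP_upper)
    then have "mean_osc lam f (J 0 v) < \<infinity>" using f by (auto simp: BMO_def)
    then have "(\<integral>\<^sup>+x\<in>J 0 v. ennreal (norm (f x - ?c)) \<partial>M) \<noteq> \<infinity>"
      using v by (auto simp: mean_osc_def emeasure_J ennreal_top_divide)
    then have "(\<integral>\<^sup>+x. ennreal (norm (indicator (J 0 v) x *\<^sub>R (f x - ?c))) \<partial>M) < \<infinity>"
      by (simp add: less_top indicator_mult_ennreal mult.commute)
    then have "set_integrable M (J 0 v) (\<lambda>x. f x - ?c)"
      unfolding set_integrable_def by (intro integrableI_bounded) measurable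
    from set_integral_add(1)[OF this set_integrable_const_J[of 0 v ?c]] v
    show ?thesis by simp
  qed
qed

end

section \<open>Smooth functions with compact support\<close>

lemma funpow_vector_derivative_closed:
  fixes C :: "(real \<Rightarrow> 'a::real_normed_vector) set"
  assumes C: "\<And>g. g \<in> C \<Longrightarrow> \<exists>g'\<in>C. \<forall>x. (g has_vector_derivative g' x) (at x)" and "g \<in> C"
  shows "((\<lambda>g t. vector_derivative g (at t)) ^^ n) g \<in> C"
proof (induction n)
  case (Suc n)
  then obtain g' where g': "g' \<in> C"
    "\<And>x. (((\<lambda>g t. vector_derivative g (at t)) ^^ n) g has_vector_derivative g' x) (at x)"
    using C by blast
  then have "((\<lambda>g t. vector_derivative g (at t)) ^^ Suc n) g = g'"
    by (auto simp: vector_derivative_at)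
  with g' show ?case by simp
qed (use assms in simp)

text \<open>Smoothness is shown by placing the function in a class closed under differentiation,
  with no formula for the higher derivatives.\<close>

lemma smooth_pos_closed:
  fixes C :: "(real \<Rightarrow> 'a::real_normed_vector) set"
  assumes C: "\<And>g. g \<in> C \<Longrightarrow> \<exists>g'\<in>C. \<forall>x. (g has_vector_derivative g' x) (at x)" and "g \<in> C"
  shows "smooth_pos g"
  unfolding smooth_pos_def
  using C[OF funpow_vector_derivative_closed[OF assms]] differentiableI_vector by blast

text \<open>The polynomial factor makes this class closed under differentiation.\<close>

definition flat_exp :: "real poly \<Rightarrow> real \<Rightarrow> real" where
  "flat_exp p x = (if 0 < x then poly p (1 / x) * exp (- 1 / x) else 0)"

lemma poly_times_exp_minus_tendsto_0: "((\<lambda>t. poly p t * exp (- t)) \<longlongrightarrow> 0) at_top" for p :: "real poly"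
proof -
  have "((\<lambda>t. \<Sum>i\<le>degree p. coeff p i * (t ^ i / exp t)) \<longlongrightarrow> (\<Sum>i\<le>degree p. coeff p i * 0)) at_top"
    by (intro tendsto_intros tendsto_power_div_exp_0)
  then show ?thesis
    by (simp add: poly_altdef exp_minus sum_distrib_right divide_inverse mult.assoc)
qed

text \<open>For positive x the derivative is x^(-2) (p(1/x) - p'(1/x)) exp(-1/x), and
  \<open>[:0, 0, 1:]\<close> is the factor x^(-2) read as a polynomial in 1/x. At 0 both one-sided
  difference quotients tend to 0.\<close>

lemma DERIV_flat_exp:
  "(flat_exp p has_real_derivative flat_exp ([:0, 0, 1:] * (p - pderiv p)) x) (at x)"
proof (cases x "0::real" rule: linorder_cases)
  case less
  have "(flat_exp p has_real_derivative 0) (at x)"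
    by (rule has_field_derivative_transform_within_open[of "\<lambda>x. 0" _ _ "{..<0}"])
      (use less in \<open>auto simp: flat_exp_def\<close>)
  then show ?thesis using less by (simp add: flat_exp_def)
next
  case greater
  have "((\<lambda>x. poly p (1 / x) * exp (- 1 / x)) has_real_derivative
     flat_exp ([:0, 0, 1:] * (p - pderiv p)) x) (at x)"
    using greater
    by (auto intro!: derivative_eq_intros DERIV_chain2[OF poly_DERIV]
        simp: flat_exp_def field_simps power2_eq_square)
  then show ?thesis
    by (rule has_field_derivative_transform_within_open[of _ _ _ "{0<..}"])
      (use greater in \<open>auto simp: flat_exp_def\<close>)
next
  case equal
  have "((\<lambda>h. flat_exp p h / h) \<longlongrightarrow> 0) (at_left 0)"
    by (rule tendsto_eventually) (auto simp: flat_exp_def eventually_at_filter)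
  moreover have "((\<lambda>h. flat_exp p h / h) \<longlongrightarrow> 0) (at_right 0)"
  proof -
    \<comment> \<open>Dividing by \<open>h\<close> multiplies by 1/h, which turns \<open>p\<close>
      into \<open>pCons 0 p\<close> as a polynomial in 1/h.\<close>
    have "((\<lambda>h. poly (pCons 0 p) (inverse h) * exp (- inverse h)) \<longlongrightarrow> 0) (at_right (0::real))"
      by (rule filterlim_compose[OF poly_times_exp_minus_tendsto_0 filterlim_inverse_at_top_right])
    moreover have "eventually (\<lambda>h. poly (pCons 0 p) (inverse h) * exp (- inverse h) = flat_exp p h / h) (at_right (0::real))"
      using eventually_at_right_less[of "0::real"]
      by eventually_elim (simp add: flat_exp_def field_simps)
    ultimately show ?thesis by (rule Lim_transform_eventually)
  qed
  ultimately have "((\<lambda>h. flat_exp p h / h) \<longlongrightarrow> 0) (at 0)"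
    by (simp add: filterlim_split_at)
  then show ?thesis using equal by (simp add: DERIV_def flat_exp_def)
qed

text \<open>By the product rule the derivative of a generator is a sum of three generators, hence
  the closure under sums. The vector-valued polynomial \<open>r\<close> is what Stone-Weierstrass
  will supply.\<close>

inductive_set bump_span :: "real \<Rightarrow> real \<Rightarrow> (real \<Rightarrow> 'a::euclidean_space) set" for \<alpha> \<beta> where
  base: "polynomial_function r \<Longrightarrow> (\<lambda>x. (flat_exp p (x - \<alpha>) * flat_exp q (\<beta> - x)) *\<^sub>R r x) \<in> bump_span \<alpha> \<beta>"
| add: "g \<in> bump_span \<alpha> \<beta> \<Longrightarrow> h \<in> bump_span \<alpha> \<beta> \<Longrightarrow> (\<lambda>x. g x + h x) \<in> bump_span \<alpha> \<beta>"

lemma bump_span_derivative: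
  assumes "g \<in> bump_span \<alpha> \<beta>"
  shows "\<exists>g'\<in>bump_span \<alpha> \<beta>. \<forall>x. (g has_vector_derivative g' x) (at x)"
  using assms
proof induction
  case (base r p q)
  obtain r' where r': "polynomial_function r'" "\<And>x. (r has_vector_derivative r' x) (at x)"
    using has_vector_derivative_polynomial_function[OF base] by blast
  define p' q' where "p' = [:0, 0, 1:] * (p - pderiv p)" and "q' = [:0, 0, 1:] * (q - pderiv q)"
  \<comment> \<open>The inner derivative of \<open>\<beta> - x\<close> is -1; the sign goes onto
    \<open>r\<close>, so that the middle term is a generator too.\<close>
  let ?g' = "\<lambda>x. (flat_exp p' (x - \<alpha>) * flat_exp q (\<beta> - x)) *\<^sub>R r x
     + ((flat_exp p (x - \<alpha>) * flat_exp q' (\<beta> - x)) *\<^sub>R (- r x)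
     + (flat_exp p (x - \<alpha>) * flat_exp q (\<beta> - x)) *\<^sub>R r' x)"
  have "?g' \<in> bump_span \<alpha> \<beta>"
    using base r' by (intro bump_span.intros polynomial_function_minus)
  moreover have "((\<lambda>x. (flat_exp p (x - \<alpha>) * flat_exp q (\<beta> - x)) *\<^sub>R r x) has_vector_derivative ?g' x) (at x)" for x
  proof -
    have p: "((\<lambda>x. flat_exp p (x - \<alpha>)) has_real_derivative flat_exp p' (x - \<alpha>) * (1 - 0)) (at x)"
      unfolding p'_def by (intro DERIV_chain2[OF DERIV_flat_exp] derivative_intros)
    have q: "((\<lambda>x. flat_exp q (\<beta> - x)) has_real_derivative flat_exp q' (\<beta> - x) * (0 - 1)) (at x)"
      unfolding q'_def by (intro DERIV_chain2[OF DERIV_flat_exp] derivative_intros)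
    show ?thesis
      using has_vector_derivative_scaleR[OF DERIV_mult[OF p q] r'(2)]
      by (simp add: algebra_simps)
  qed
  ultimately show ?case by (intro bexI[of _ ?g'] allI)
next
  case (add g h)
  then obtain g' h' where "g' \<in> bump_span \<alpha> \<beta>" "\<forall>x. (g has_vector_derivative g' x) (at x)"
    "h' \<in> bump_span \<alpha> \<beta>" "\<forall>x. (h has_vector_derivative h' x) (at x)" by blast
  then show ?case
    by (intro bexI[of _ "\<lambda>x. g' x + h' x"]) (auto intro: bump_span.add has_vector_derivative_add)
qed

lemma bump_span_support: "g \<in> bump_span \<alpha> \<beta> \<Longrightarrow> x \<notin> {\<alpha>..\<beta>} \<Longrightarrow> g x = 0"
  by (induction rule: bump_span.induct) (auto simp: flat_exp_def)

lemma bump_span_test_function: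
  assumes "g \<in> bump_span \<alpha> \<beta>" "0 < \<alpha>"
  shows "g \<in> test_functions"
proof -
  have "closure {x. 0 < x \<and> g x \<noteq> 0} \<subseteq> {\<alpha>..\<beta>}"
    using bump_span_support[OF assms(1)] by (intro closure_minimal subsetI) (blast, simp)
  then have "{0<..} \<inter> closure {x. 0 < x \<and> g x \<noteq> 0} = closure {x. 0 < x \<and> g x \<noteq> 0}"
    and "bounded (closure {x. 0 < x \<and> g x \<noteq> 0})"
    using assms(2) by (auto intro: bounded_subset[OF bounded_closed_interval])
  moreover have "smooth_pos g"
    using bump_span_derivative assms(1) by (rule smooth_pos_closed)
  ultimately show ?thesis
    by (simp add: test_functions_def compact_eq_bounded_closed)
qed

text \<open>Instead of mollifying, \<open>k\<close> is divided by a smooth weight \<open>w\<close>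
  that is positive exactly inside (\<open>\<alpha>\<close>, \<open>\<beta>\<close>), the quotient is
  approximated by a polynomial, and the result is multiplied by \<open>w\<close> again. As
  \<open>w\<close> is at most 1, the error does not grow.\<close>

lemma test_function_approx:
  fixes k :: "real \<Rightarrow> 'a::euclidean_space"
  assumes \<alpha>: "0 < \<alpha>" "\<alpha> < \<alpha>'" "\<alpha>' \<le> \<beta>'" "\<beta>' < \<beta>"
    and k: "continuous_on {\<alpha>..\<beta>} k"
    and k0: "\<And>x. x \<notin> {\<alpha>'<..<\<beta>'} \<Longrightarrow> k x = 0" and e: "0 < e"
  obtains \<phi> where "\<phi> \<in> test_functions" "\<And>x. norm (k x - \<phi> x) \<le> e"
proof -
  define w where "w x = flat_exp 1 (x - \<alpha>) * flat_exp 1 (\<beta> - x)" for x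
  have w_pos: "0 < w x" if "\<alpha> < x" "x < \<beta>" for x
    using that by (simp add: w_def flat_exp_def)
  have "0 \<le> flat_exp 1 x" "flat_exp 1 x \<le> 1" for x by (auto simp: flat_exp_def)
  then have w_le: "0 \<le> w x" "w x \<le> 1" for x by (auto simp: w_def intro!: mult_le_one)
  have "isCont (flat_exp 1) x" for x using DERIV_isCont[OF DERIV_flat_exp] .
  then have cont_flat: "continuous_on UNIV (flat_exp 1)"
    by (simp add: continuous_on_eq_continuous_at)
  have cont_w: "continuous_on S w" for S
    unfolding w_def by (intro continuous_intros continuous_on_compose2[OF cont_flat]) auto
  define q where "q x = (1 / w x) *\<^sub>R k x" for x
  \<comment> \<open>A genuine quotient occurs only on the middle interval, where \<open>w\<close> is
    positive. On the outer two \<open>k\<close> vanishes, and so does \<open>q\<close>.\<close>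
  have "continuous_on ({\<alpha>..\<alpha>'} \<union> {\<alpha>'..\<beta>'} \<union> {\<beta>'..\<beta>}) q"
  proof (intro continuous_on_closed_Un closed_Un closed_atLeastAtMost)
    have k_end: "k x = 0" if "x \<in> {\<alpha>..\<alpha>'} \<union> {\<beta>'..\<beta>}" for x
      using that by (intro k0) auto
    have "w x \<noteq> 0" if "x \<in> {\<alpha>'..\<beta>'}" for x
      using that \<alpha> by (intro less_imp_neq[symmetric] w_pos) auto
    then show "continuous_on {\<alpha>'..\<beta>'} q"
      unfolding q_def using \<alpha>
      by (intro continuous_intros cont_w continuous_on_subset[OF k]) auto
    show "continuous_on {\<alpha>..\<alpha>'} q" "continuous_on {\<beta>'..\<beta>} q"
      by (rule continuous_on_eq[OF continuous_on_const[of _ 0]]; simp add: q_def k_end)+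
  qed
  moreover have "{\<alpha>..\<alpha>'} \<union> {\<alpha>'..\<beta>'} \<union> {\<beta>'..\<beta>} = {\<alpha>..\<beta>}" using \<alpha> by auto
  ultimately have "continuous_on {\<alpha>..\<beta>} q" by simp
  from Stone_Weierstrass_polynomial_function[OF compact_Icc this e]
  obtain r where r: "polynomial_function r" "\<forall>x\<in>{\<alpha>..\<beta>}. norm (q x - r x) < e" by (elim exE conjE)
  define \<phi> where "\<phi> x = w x *\<^sub>R r x" for x
  have "\<phi> \<in> bump_span \<alpha> \<beta>"
    unfolding \<phi>_def w_def by (rule bump_span.base[OF r(1)])
  then have "\<phi> \<in> test_functions" using \<alpha>(1) by (rule bump_span_test_function)
  moreover have "norm (k x - \<phi> x) \<le> e" for x
  proof (cases "\<alpha> < x \<and> x < \<beta>")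
    case True
    then have "k x - \<phi> x = w x *\<^sub>R (q x - r x)"
      using w_pos[of x] by (simp add: \<phi>_def q_def scaleR_diff_right)
    then have "norm (k x - \<phi> x) \<le> 1 * e"
      using w_le[of x] bspec[OF r(2), of x] True
      by (simp only: norm_scaleR abs_of_nonneg) (intro mult_mono, auto)
    then show ?thesis by simp
  next
    case False
    then have "k x = 0" "w x = 0" using \<alpha> k0[of x] by (auto simp: w_def flat_exp_def)
    then show ?thesis using e by (simp add: \<phi>_def)
  qed
  ultimately show ?thesis by (rule that)
qed

lemma test_function_uniformly_continuous:
  fixes \<phi> :: "real \<Rightarrow> 'a::euclidean_space"
  assumes \<phi>: "\<phi> \<in> test_functions"
  obtains \<alpha> \<beta> where "0 < \<alpha>" "\<alpha> \<le> \<beta>" "\<And>x. 0 < x \<Longrightarrow> x \<notin> {\<alpha>..\<beta>} \<Longrightarrow> \<phi> x = 0"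
    "uniformly_continuous_on {0<..} \<phi>"
proof -
  define K where "K = {0<..} \<inter> closure {x. 0 < x \<and> \<phi> x \<noteq> 0}"
  have K: "compact K" using \<phi> unfolding test_functions_def K_def by blast
  have K_pos: "0 < x" if "x \<in> K" for x using that by (simp add: K_def)
  have "\<exists>\<alpha> \<beta>. 0 < \<alpha> \<and> \<alpha> \<le> \<beta> \<and> K \<subseteq> {\<alpha>..\<beta>}"
  proof (cases "K = {}")
    case True
    have "0 < (1::real) \<and> (1::real) \<le> 1 \<and> K \<subseteq> {1..1}" using True by simp
    then show ?thesis by blast
  next
    case False
    obtain a where a: "a \<in> K" "\<And>x. x \<in> K \<Longrightarrow> a \<le> x"
      using compact_attains_inf[OF K False] by blast
    obtain b where b: "b \<in> K" "\<And>x. x \<in> K \<Longrightarrow> x \<le> b"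
      using compact_attains_sup[OF K False] by blast
    have "K \<subseteq> {a..b}" using a(2) b(2) by (simp add: subset_iff)
    moreover have "0 < a" "a \<le> b" using K_pos[OF a(1)] b(2)[OF a(1)] by simp_all
    ultimately show ?thesis by blast
  qed
  then obtain \<alpha> \<beta> where ab: "0 < \<alpha>" "\<alpha> \<le> \<beta>" "K \<subseteq> {\<alpha>..\<beta>}" by blast
  have zero: "\<phi> x = 0" if "0 < x" "x \<notin> {\<alpha>..\<beta>}" for x
  proof (rule ccontr)
    assume "\<phi> x \<noteq> 0"
    then have "x \<in> K" using that(1) closure_subset[of "{x. 0 < x \<and> \<phi> x \<noteq> 0}"] by (auto simp: K_def)
    then show False using ab(3) that(2) by blast
  qed
  \<comment> \<open>The zeroth iterate is the identity, so \<open>n = 0\<close> in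
    \<open>smooth_pos\<close> says that \<open>\<phi>\<close> itself is differentiable.\<close>
  have "((\<lambda>g t. vector_derivative g (at t)) ^^ 0) \<phi> differentiable (at x)" if "0 < x" for x
    using \<phi> that unfolding test_functions_def smooth_pos_def by blast
  then have "\<phi> differentiable (at x)" if "0 < x" for x using that by simp
  then have cont: "continuous_on {0<..} \<phi>"
    by (intro continuous_at_imp_continuous_on) (auto intro: differentiable_imp_continuous_within)
  have "uniformly_continuous_on {0<..} \<phi>"
    unfolding uniformly_continuous_on_def
  proof (intro allI impI)
    fix e :: real assume e: "0 < e"
    have "uniformly_continuous_on {\<alpha> / 2..\<beta> + 1} \<phi>"
      using ab by (intro compact_uniformly_continuous continuous_on_subset[OF cont]) auto
    then obtain d where d: "d > 0"
      "\<forall>x\<in>{\<alpha> / 2..\<beta> + 1}. \<forall>y\<in>{\<alpha> / 2..\<beta> + 1}. dist y x < d \<longrightarrow> dist (\<phi> y) (\<phi> x) < e"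
      using e unfolding uniformly_continuous_on_def by blast
    \<comment> \<open>If one of the points lies in the support interval, both lie in the enlarged
      compact interval; otherwise both values are 0.\<close>
    have "dist (\<phi> y) (\<phi> x) < e" if "0 < x" "0 < y" "dist y x < min d (min (\<alpha> / 2) 1)" for x y
    proof (cases "x \<in> {\<alpha>..\<beta>} \<or> y \<in> {\<alpha>..\<beta>}")
      case True
      moreover have "\<bar>y - x\<bar> < \<alpha> / 2" "\<bar>y - x\<bar> < 1" using that(3) by (simp_all add: dist_real_def)
      ultimately have "x \<in> {\<alpha> / 2..\<beta> + 1}" "y \<in> {\<alpha> / 2..\<beta> + 1}"
        using ab(1,2) unfolding atLeastAtMost_iff by linarith+
      then show ?thesis using d(2) that(3) by simp
    next
      case False
      then show ?thesis using zero[OF that(1)] zero[OF that(2)] e by simp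
    qed
    then show "\<exists>d>0. \<forall>x\<in>{0<..}. \<forall>y\<in>{0<..}. dist y x < d \<longrightarrow> dist (\<phi> y) (\<phi> x) < e"
      using d(1) ab(1) by (intro exI[of _ "min d (min (\<alpha> / 2) 1)"]) simp
  qed
  from that[OF ab(1,2) zero this] show ?thesis .
qed

section \<open>Continuity of the primitive; the logarithmic cutoff\<close>

context half_line
begin

text \<open>Dominated convergence along a sequence: its bound \<open>B\<close> gives the majorant
  \<open>norm (f x)\<close> on \<open>J 0 B\<close>.\<close>

lemma continuous_on_integral_J:
  fixes f :: "real \<Rightarrow> 'b::euclidean_space"
  assumes f: "loc_integrable f"
  shows "continuous_on {0..} (\<lambda>u. LINT x:J 0 u|M. f x)"
  unfolding continuous_on_sequentially
proof (intro allI ballI impI, elim conjE)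
  fix s :: "nat \<Rightarrow> real" and a assume a: "a \<in> {0..}" and s: "\<forall>n. s n \<in> {0..}" "s \<longlonglongrightarrow> a"
  obtain B where B: "\<And>n. norm (s n) \<le> B"
    using convergent_imp_Bseq[of s] s(2) unfolding convergent_def Bseq_def by blast
  have B0: "0 \<le> B" using B[of 0] norm_ge_zero order_trans by blast
  have s0: "0 \<le> s n" "s n \<le> B" for n using s(1) B[of n] by auto
  have i: "set_integrable M (J 0 B) f" using f B0 by (intro loc_integrableD) auto
  have m: "(\<lambda>x. indicator (J 0 u) x *\<^sub>R f x) \<in> borel_measurable M" if "0 \<le> u" for u
    using loc_integrableD[OF f order_refl that] by (auto simp: set_integrable_def)
  \<comment> \<open>Only at \<open>G a\<close> can the indicators fail to converge; for
    \<open>a = 0\<close> this point lies outside the half line.\<close>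
  have ae: "AE x in M. x \<noteq> G a"
  proof (cases "a = 0")
    case True
    then show ?thesis by (intro AE_I2) (auto simp: space_m_lam)
  next
    case False
    then show ?thesis using a G_strict_mono[of 0 a] by (intro AE_neq_point) auto
  qed
  have "(\<lambda>n. LINT x:J 0 (s n)|M. f x) \<longlonglongrightarrow> (LINT x:J 0 a|M. f x)"
    unfolding set_lebesgue_integral_def
  proof (rule integral_dominated_convergence[where w = "\<lambda>x. norm (indicator (J 0 B) x *\<^sub>R f x)"])
    show "integrable M (\<lambda>x. norm (indicator (J 0 B) x *\<^sub>R f x))"
      using i unfolding set_integrable_def by (rule integrable_norm)
    show "AE x in M. norm (indicator (J 0 (s n)) x *\<^sub>R f x) \<le> norm (indicator (J 0 B) x *\<^sub>R f x)" for n
    proof (rule AE_I2)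
      fix x
      have "J 0 (s n) \<subseteq> J 0 B" using s0 B0 by (intro J_mono) auto
      then show "norm (indicator (J 0 (s n)) x *\<^sub>R f x) \<le> norm (indicator (J 0 B) x *\<^sub>R f x)"
        by (auto simp: indicator_def)
    qed
    show "AE x in M. (\<lambda>n. indicator (J 0 (s n)) x *\<^sub>R f x) \<longlonglongrightarrow> indicator (J 0 a) x *\<^sub>R f x"
      using ae AE_space
    proof eventually_elim
      case (elim x)
      then have x: "0 < x" by (simp add: space_m_lam)
      have "F x \<noteq> a" using elim x by force
      then consider "F x < a" | "a < F x" by linarith
      then have "eventually (\<lambda>n. indicator (J 0 (s n)) x *\<^sub>R f x = indicator (J 0 a) x *\<^sub>R f x) sequentially"
      proof cases
        case 1
        with s(2) have "eventually (\<lambda>n. F x < s n) sequentially" by (rule order_tendstoD(1))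
        then show ?thesis
          by eventually_elim (use 1 x a s0(1) in \<open>simp add: indicator_def mem_J_iff\<close>)
      next
        case 2
        with s(2) have "eventually (\<lambda>n. s n < F x) sequentially" by (rule order_tendstoD(2))
        then show ?thesis
          by eventually_elim (use 2 x a s0(1) in \<open>simp add: indicator_def mem_J_iff\<close>)
      qed
      then show ?case by (rule tendsto_eventually)
    qed
  qed (use m a s0 in auto)
  then show "((\<lambda>u. LINT x:J 0 u|M. f x) \<circ> s) \<longlonglongrightarrow> (LINT x:J 0 a|M. f x)"
    by (simp add: o_def)
qed

lemma set_integral_sqrt_J:
  assumes "0 \<le> u" "u < v"
  shows "set_integrable M (J u v) (\<lambda>x. sqrt (v / F x))" (is ?i)
    and "(LINT x:J u v|M. sqrt (v / F x)) \<le> 2 * (v - u)"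
proof -
  have "(\<lambda>x. sqrt (v / F x)) \<in> borel_measurable (lebesgue_on {0<..})"
    by (intro measurable_restrict_space1 measurable_completion) simp
  then have [measurable]: "(\<lambda>x. sqrt (v / F x)) \<in> borel_measurable M" by (simp add: m_lam_def)
  have pos: "0 \<le> indicator (J u v) x * sqrt (v / F x)" for x
    using assms by (auto simp: indicator_def)
  have eq: "(\<integral>\<^sup>+x. ennreal (indicator (J u v) x * sqrt (v / F x)) \<partial>M)
      = (\<integral>\<^sup>+x\<in>J u v. ennreal (sqrt (v / F x)) \<partial>M)"
    by (intro nn_integral_cong) (auto simp: indicator_def)
  show i: ?i
    unfolding set_integrable_def
  proof (rule integrableI_nonneg)
    show "(\<integral>\<^sup>+x. ennreal (indicator (J u v) x *\<^sub>R sqrt (v / F x)) \<partial>M) < \<infinity>"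
      using le_less_trans[OF nn_integral_sqrt_J[OF assms]] eq by simp
  qed (use pos in auto)
  have "ennreal (LINT x:J u v|M. sqrt (v / F x)) \<le> ennreal (2 * (v - u))"
    using nn_integral_eq_integral[OF i[unfolded set_integrable_def]] pos eq nn_integral_sqrt_J[OF assms]
    by (simp add: set_lebesgue_integral_def)
  then show "(LINT x:J u v|M. sqrt (v / F x)) \<le> 2 * (v - u)" using assms by simp
qed

text \<open>For positive \<open>K\<close>, \<open>d\<close> and \<open>y\<close> it is 1 up to
  \<open>d * exp (- K)\<close>, 0 from \<open>d\<close> on, and affine in \<open>ln y\<close>
  between. A large \<open>K\<close> makes the transition slow and the oscillation small.\<close>

definition log_cutoff :: "real \<Rightarrow> real \<Rightarrow> real \<Rightarrow> real" where
  "log_cutoff K d y = max 0 (min 1 (ln (d / y) / K))"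

lemma log_cutoff_bounds: "0 \<le> log_cutoff K d y" "log_cutoff K d y \<le> 1"
  by (auto simp: log_cutoff_def)

lemma ln_le_2_sqrt: "0 < t \<Longrightarrow> ln t \<le> 2 * sqrt t"
  using ln_le_minus_one[of "sqrt t"] by (simp add: ln_sqrt)

text \<open>Truncation to [0, 1] does not increase differences, which leaves ln(v/y)/K. The
  logarithm is replaced by a square root, whose integral up to 0 is already known.\<close>

lemma log_cutoff_diff_le:
  assumes "0 < K" "0 < d" "0 < y" "y < v"
  shows "\<bar>log_cutoff K d y - log_cutoff K d v\<bar> \<le> 2 / K * sqrt (v / y)"
proof -
  have "\<bar>log_cutoff K d y - log_cutoff K d v\<bar> \<le> \<bar>ln (d / y) / K - ln (d / v) / K\<bar>"
    unfolding log_cutoff_def by (auto simp: max_def min_def abs_if)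
  also have "ln (d / y) / K - ln (d / v) / K = ln (v / y) / K"
    using assms by (simp add: ln_div diff_divide_distrib[symmetric])
  also have "\<bar>ln (v / y) / K\<bar> = ln (v / y) / K"
    using assms by (intro abs_of_nonneg divide_nonneg_pos ln_ge_zero) (auto simp: field_simps)
  also have "\<dots> \<le> 2 * sqrt (v / y) / K"
    using assms by (intro divide_right_mono ln_le_2_sqrt) auto
  finally show ?thesis by simp
qed

lemma continuous_on_log_cutoff: "0 < K \<Longrightarrow> 0 < d \<Longrightarrow> continuous_on {0<..} (log_cutoff K d)"
  unfolding log_cutoff_def by (intro continuous_intros) auto

lemma loc_integrable_log_cutoff:
  assumes "0 < K" "0 < d"
  shows "loc_integrable (\<lambda>x. log_cutoff K d (F x) *\<^sub>R c)"
proof (rule loc_integrable_bounded)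
  show "continuous_on {0<..} (\<lambda>x. log_cutoff K d (F x) *\<^sub>R c)"
    by (intro continuous_intros continuous_on_compose2[OF continuous_on_log_cutoff[OF assms]]
        continuous_on_subset[OF continuous_on_F]) (auto simp: F_pos)
  show "\<exists>B. \<forall>x\<in>J 0 v. norm (log_cutoff K d (F x) *\<^sub>R c) \<le> B" for v
    using log_cutoff_bounds[of K d] by (intro exI[of _ "norm c"]) (auto intro: mult_left_le_one_le)
qed

text \<open>The comparison constant is the value at the right end \<open>v\<close>. The mean of
  sqrt(v/y) is at most 2, so the bound is the same for all intervals.\<close>

lemma osc_le_log_cutoff:
  assumes K: "0 < K" "0 < d" and u: "0 \<le> u" "u < v"
  shows "osc_le (\<lambda>x. log_cutoff K d (F x) *\<^sub>R c) (4 * norm c / K) u v"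
proof (rule osc_leI)
  let ?w = "\<lambda>x. (norm c * 2 / K) * sqrt (v / F x)"
  have "N (\<lambda>x. log_cutoff K d (F x) *\<^sub>R c - log_cutoff K d v *\<^sub>R c) u v \<le> (LINT x:J u v|M. ?w x)"
    unfolding N_def
  proof (rule set_integral_mono)
    show "set_integrable M (J u v) (\<lambda>x. norm (log_cutoff K d (F x) *\<^sub>R c - log_cutoff K d v *\<^sub>R c))"
      using u by (intro loc_integrable_normD loc_integrable_diff loc_integrable_log_cutoff K) auto
    show "set_integrable M (J u v) ?w"
      using set_integral_sqrt_J(1)[OF u] by (intro set_integrable_mult_right)
    fix x assume "x \<in> J u v"
    then have x: "0 < F x" "F x < v" using u F_pos by (auto simp: mem_J_iff)
    have "norm (log_cutoff K d (F x) *\<^sub>R c - log_cutoff K d v *\<^sub>R c)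
        = \<bar>log_cutoff K d (F x) - log_cutoff K d v\<bar> * norm c"
      by (simp flip: scaleR_diff_left)
    also have "\<dots> \<le> 2 / K * sqrt (v / F x) * norm c"
      using K x by (intro mult_right_mono log_cutoff_diff_le) auto
    finally show "norm (log_cutoff K d (F x) *\<^sub>R c - log_cutoff K d v *\<^sub>R c) \<le> ?w x"
      by (simp add: mult_ac)
  qed
  also have "\<dots> = (norm c * 2 / K) * (LINT x:J u v|M. sqrt (v / F x))"
    by (rule set_integral_mult_right)
  also have "\<dots> \<le> (norm c * 2 / K) * (2 * (v - u))"
    using K by (intro mult_left_mono set_integral_sqrt_J(2)[OF u]) auto
  also have "\<dots> = 4 * norm c / K * (v - u)"
    using K by (simp add: field_simps)
  finally show "N (\<lambda>x. log_cutoff K d (F x) *\<^sub>R c - log_cutoff K d v *\<^sub>R c) u v \<le> 4 * norm c / K * (v - u)" .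
qed

lemma loc_integrable_test_function:
  assumes "\<phi> \<in> test_functions"
  shows "loc_integrable \<phi>"
proof -
  obtain \<alpha> \<beta> where ab: "0 < \<alpha>" "\<alpha> \<le> \<beta>" "\<And>x. 0 < x \<Longrightarrow> x \<notin> {\<alpha>..\<beta>} \<Longrightarrow> \<phi> x = 0"
    "uniformly_continuous_on {0<..} \<phi>"
    using test_function_uniformly_continuous[OF assms] by blast
  have cont: "continuous_on {0<..} \<phi>" using ab(4) by (rule uniformly_continuous_imp_continuous)
  have "bounded (\<phi> ` {\<alpha>..\<beta>})"
    using ab by (intro compact_imp_bounded compact_continuous_image continuous_on_subset[OF cont]) auto
  then obtain B where B: "\<And>x. x \<in> {\<alpha>..\<beta>} \<Longrightarrow> norm (\<phi> x) \<le> B" unfolding bounded_iff by blast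
  have "norm (\<phi> x) \<le> max B 0" if "0 < x" for x
    using B[of x] ab(3)[OF that] by (cases "x \<in> {\<alpha>..\<beta>}") auto
  then have "norm (\<phi> x) \<le> max B 0" if "x \<in> J 0 v" for x v
    using that by (auto simp: J_def)
  then show ?thesis by (intro loc_integrable_bounded cont) blast
qed

end

section \<open>Averaging at a variable scale and cutting off\<close>

locale small_osc = half_line lam for lam +
  fixes f :: "real \<Rightarrow> 'a::euclidean_space" and e d R L :: real
  assumes f: "loc_integrable f"
    and e: "0 < e" and d: "0 < d" and R: "0 \<le> R"
    and osc_small: "\<And>u v. 0 \<le> u \<Longrightarrow> u < v \<Longrightarrow> v - u \<le> 3 * d \<Longrightarrow>
      N (\<lambda>x. f x - avg lam f (J u v)) u v \<le> e * (v - u)"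
    and osc_far: "\<And>u v. R \<le> u \<Longrightarrow> u < v \<Longrightarrow> N (\<lambda>x. f x - avg lam f (J u v)) u v \<le> e * (v - u)"
    and osc_large: "\<And>u v. 0 \<le> u \<Longrightarrow> u < v \<Longrightarrow> L \<le> v - u \<Longrightarrow>
      N (\<lambda>x. f x - avg lam f (J u v)) u v \<le> e * (v - u)"
begin

text \<open>The averaging scale grows linearly at infinity. Averaging on a fixed scale would not
  do: the average could still oscillate much on intervals of length comparable to their
  distance from \<open>0\<close>, and then it cannot be cut off there.\<close>

definition scale :: "real \<Rightarrow> real" where "scale u = max d (u - R)"

text \<open>A function of the coordinate, to be composed with \<open>F\<close>. The window extends
  to the right only, so that \<open>u = 0\<close> is admissible.\<close>

definition g :: "real \<Rightarrow> 'a" where "g u = avg lam f (J u (u + scale u))"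

lemma scale_pos: "0 < scale u" and scale_ge: "d \<le> scale u"
  using d by (auto simp: scale_def)

lemma scale_mono: "u \<le> v \<Longrightarrow> scale u \<le> scale v"
  and scale_lipschitz: "u \<le> v \<Longrightarrow> scale v \<le> scale u + (v - u)"
  by (auto simp: scale_def)

text \<open>From \<open>R\<close> on, \<open>osc_far\<close> applies at any length; before
  \<open>R\<close> the scale is \<open>d\<close>, and \<open>osc_small\<close> applies.\<close>

lemma osc_scale:
  assumes "0 \<le> u" "u < v" "v \<le> u + 3 * scale u"
  shows "N (\<lambda>x. f x - avg lam f (J u v)) u v \<le> e * (v - u)"
proof (cases "R \<le> u")
  case False
  then have "scale u = d" using d by (simp add: scale_def)
  then show ?thesis using assms by (intro osc_small) auto
qed (use assms osc_far in auto)

text \<open>Here \<open>c\<close> is the average over three scales, which is why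
  \<open>osc_small\<close> reaches up to \<open>3 * d\<close>. For \<open>w\<close> in the first
  scale, \<open>scale w\<close> is at most \<open>2 * scale u\<close>, so the window of
  \<open>w\<close> fits inside; it fills at least a third of the long interval, hence
  \<open>3 * e\<close>.\<close>

lemma g_near_const:
  assumes u: "0 \<le> u"
  obtains c where "N (\<lambda>x. f x - c) u (u + scale u) \<le> 3 * e * scale u"
    "\<And>w. u \<le> w \<Longrightarrow> w \<le> u + scale u \<Longrightarrow> norm (g w - c) \<le> 3 * e"
proof -
  let ?v = "u + 3 * scale u"
  define c where "c = avg lam f (J u ?v)"
  have li: "loc_integrable (\<lambda>x. f x - c)" using f by auto
  have c: "N (\<lambda>x. f x - c) u ?v \<le> 3 * e * scale u"
    using osc_scale[OF u, of ?v] scale_pos[of u] by (simp add: c_def)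
  have "N (\<lambda>x. f x - c) u (u + scale u) \<le> N (\<lambda>x. f x - c) u ?v"
    using u scale_pos[of u] by (intro N_mono_interval[OF li]) auto
  moreover have "norm (g w - c) \<le> 3 * e" if w: "u \<le> w" "w \<le> u + scale u" for w
  proof -
    have sw: "scale u \<le> scale w" "scale w \<le> 2 * scale u" "0 < scale w"
      using scale_mono[OF w(1)] scale_lipschitz[OF w(1)] w scale_pos[of w] by auto
    have "scale w * norm (g w - c) \<le> N (\<lambda>x. f x - c) w (w + scale w)"
      using norm_avg_diff_le[OF f, of w "w + scale w" c] u w sw by (simp add: g_def)
    also have "\<dots> \<le> N (\<lambda>x. f x - c) u ?v"
      using u w sw by (intro N_mono_interval[OF li]) auto
    also have "\<dots> \<le> 3 * e * scale w"
      using c mult_left_mono[OF sw(1), of "3 * e"] e by linarith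
    finally have "scale w * norm (g w - c) \<le> scale w * (3 * e)" by (simp add: mult_ac)
    then show ?thesis using sw(3) by simp
  qed
  ultimately show ?thesis using c by (intro that[of c]) auto
qed

lemma g_near: "0 \<le> u \<Longrightarrow> u \<le> v \<Longrightarrow> v \<le> u + scale u \<Longrightarrow> norm (g v - g u) \<le> 6 * e"
proof -
  assume u: "0 \<le> u" "u \<le> v" "v \<le> u + scale u"
  obtain c where c: "\<And>w. u \<le> w \<Longrightarrow> w \<le> u + scale u \<Longrightarrow> norm (g w - c) \<le> 3 * e"
    using g_near_const[OF u(1)] by blast
  have "norm (g v - g u) \<le> norm (g v - c) + norm (g u - c)"
    using norm_triangle_ineq4[of "g v - c" "g u - c"] by simp
  then show ?thesis using c[of v] c[of u] u scale_pos[of u] by simp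
qed

lemma continuous_on_g: "continuous_on {0..} g"
proof -
  let ?I = "\<lambda>u. LINT x:J 0 u|M. f x"
  \<comment> \<open>\<open>g\<close> is a difference quotient of the continuous primitive of
    \<open>f\<close>.\<close>
  have eq: "g u = (1 / scale u) *\<^sub>R (?I (u + scale u) - ?I u)" if "u \<in> {0..}" for u
  proof -
    have "?I (u + scale u) = ?I u + (LINT x:J u (u + scale u)|M. f x)"
      using that scale_pos[of u] by (intro integral_split loc_integrableD[OF f]) auto
    then show ?thesis using that scale_pos[of u] by (simp add: g_def avg_J)
  qed
  have sc: "continuous_on {0..} scale" unfolding scale_def by (intro continuous_intros)
  have "scale u \<noteq> 0" for u using scale_pos[of u] by simp
  moreover have "u + scale u \<in> {0..}" if "u \<in> {0..}" for u using that scale_pos[of u] by simp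
  then have "continuous_on {0..} (\<lambda>u. ?I (u + scale u))"
    by (intro continuous_on_compose2[OF continuous_on_integral_J[OF f]] continuous_on_add sc
        continuous_on_id image_subsetI)
  ultimately have "continuous_on {0..} (\<lambda>u. (1 / scale u) *\<^sub>R (?I (u + scale u) - ?I u))"
    by (intro continuous_on_scaleR continuous_on_divide continuous_on_const continuous_on_diff
        continuous_on_integral_J f sc ballI)
  moreover have "continuous_on {0..} g \<longleftrightarrow>
      continuous_on {0..} (\<lambda>u. (1 / scale u) *\<^sub>R (?I (u + scale u) - ?I u))"
    by (intro continuous_on_cong refl eq)
  ultimately show ?thesis by simp
qed

lemma loc_integrable_g: "loc_integrable (\<lambda>x. g (F x))"
  by (rule loc_integrable_comp_F[OF continuous_on_g])

lemma N_f_minus_g_step: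
  assumes u: "0 \<le> u" shows "N (\<lambda>x. f x - g (F x)) u (u + scale u) \<le> 6 * e * scale u"
proof -
  obtain c where c: "N (\<lambda>x. f x - c) u (u + scale u) \<le> 3 * e * scale u"
    "\<And>w. u \<le> w \<Longrightarrow> w \<le> u + scale u \<Longrightarrow> norm (g w - c) \<le> 3 * e"
    using g_near_const[OF u] by blast
  have "N (\<lambda>x. c - g (F x)) u (u + scale u) \<le> 3 * e * (u + scale u - u)"
    using u scale_pos[of u] e c(2) loc_integrable_g
    by (intro N_le_bound) (auto simp: mem_J_iff norm_minus_commute)
  moreover have "N (\<lambda>x. f x - g (F x)) u (u + scale u)
      \<le> N (\<lambda>x. f x - c) u (u + scale u) + N (\<lambda>x. c - g (F x)) u (u + scale u)"
    using u scale_pos[of u] by (intro N_triangle_diff f loc_integrable_g) auto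
  ultimately show ?thesis using c(1) by simp
qed

text \<open>The interval is covered by consecutive windows, each costing \<open>6 * e\<close> times
  its length. The last one may overshoot \<open>v\<close>; the term \<open>scale v\<close> pays for
  that.\<close>

lemma N_f_minus_g:
  assumes "0 \<le> u" "u \<le> v" shows "N (\<lambda>x. f x - g (F x)) u v \<le> 6 * e * (v - u + scale v)"
proof -
  have li: "loc_integrable (\<lambda>x. f x - g (F x))" using f loc_integrable_g by auto
  \<comment> \<open>Each window has length at least \<open>d\<close>, so an induction on the number
    of steps of length \<open>d\<close> reaches \<open>v\<close>.\<close>
  have "N (\<lambda>x. f x - g (F x)) u v \<le> 6 * e * (v - u + scale v)"
    if "0 \<le> u" "u \<le> v" "v - u \<le> real n * d" for n u
    using that
  proof (induction n arbitrary: u)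
    case 0
    then have "J u v = {}" by (auto simp: J_def)
    then show ?case using 0 e scale_pos[of v] by (simp add: N_def set_lebesgue_integral_def)
  next
    case (Suc n)
    show ?case
    proof (cases "v \<le> u + scale u")
      case True
      have "N (\<lambda>x. f x - g (F x)) u v \<le> N (\<lambda>x. f x - g (F x)) u (u + scale u)"
        using Suc.prems True by (intro N_mono_interval[OF li]) auto
      also have "\<dots> \<le> 6 * e * scale u" using Suc.prems by (intro N_f_minus_g_step) auto
      also have "\<dots> \<le> 6 * e * (v - u + scale v)"
        using Suc.prems e scale_mono[of u v] by (intro mult_left_mono) auto
      finally show ?thesis .
    next
      case False
      let ?w = "u + scale u"
      have w: "0 \<le> ?w" "?w \<le> v" "v - ?w \<le> real n * d"
        using Suc.prems False scale_ge[of u] scale_pos[of u] by (auto simp: algebra_simps)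
      have "N (\<lambda>x. f x - g (F x)) u v = N (\<lambda>x. f x - g (F x)) u ?w + N (\<lambda>x. f x - g (F x)) ?w v"
        using Suc.prems False scale_pos[of u] by (intro N_split[OF li]) auto
      also have "\<dots> \<le> 6 * e * scale u + 6 * e * (v - ?w + scale v)"
        using Suc.prems by (intro add_mono N_f_minus_g_step Suc.IH w) auto
      finally show ?thesis by (simp add: algebra_simps)
    qed
  qed
  moreover obtain n where "v - u \<le> real n * d"
    using ex_less_of_nat_mult[OF d, of "v - u"] less_imp_le by blast
  ultimately show ?thesis using assms by blast
qed

text \<open>Within one window \<open>f\<close> and \<open>g\<close> separately oscillate little. On
  a longer interval \<open>scale v\<close> is at most \<open>2 * (v - u)\<close>, and
  \<open>N_f_minus_g\<close> gives 6 * 3 = 18.\<close>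

lemma osc_f_minus_g:
  assumes u: "0 \<le> u" "u < v" shows "osc_le (\<lambda>x. f x - g (F x)) (18 * e) u v"
proof (cases "v \<le> u + scale u")
  case True
  let ?a = "avg lam f (J u v)"
  have "osc_le f e u v"
    using osc_scale[OF u] True scale_pos[of u] by (intro osc_leI) auto
  moreover have "osc_le (\<lambda>x. g (F x)) (6 * e) u v"
    using u e True g_near by (intro osc_le_bounded[of _ _ _ "g u"] loc_integrable_g) (auto simp: mem_J_iff)
  ultimately have "osc_le (\<lambda>x. f x - g (F x)) (e + 6 * e) u v"
    using u by (intro osc_le_diff f loc_integrable_g) auto
  then obtain c where "N (\<lambda>x. f x - g (F x) - c) u v \<le> (e + 6 * e) * (v - u)"
    by (auto simp: osc_le_def)
  also have "\<dots> \<le> 18 * e * (v - u)" using u e by (intro mult_right_mono) auto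
  finally show ?thesis by (rule osc_leI)
next
  case False
  have "N (\<lambda>x. f x - g (F x)) u v \<le> 6 * e * (v - u + scale v)"
    using u by (intro N_f_minus_g) auto
  also have "\<dots> \<le> 6 * e * (3 * (v - u))"
    using False u e scale_lipschitz[of u v] by (intro mult_left_mono) auto
  finally show ?thesis by (intro osc_leI[of _ 0]) (simp add: algebra_simps)
qed

text \<open>The interval lies before \<open>A\<close>, beyond \<open>A\<close>, or across
  \<open>A\<close> with its right end inside or outside the window of \<open>A\<close>. As
  \<open>2 * R \<le> A\<close> makes \<open>scale A\<close> at least \<open>A / 2\<close>, an
  interval of the last kind has length at least \<open>v / 3\<close>.\<close>

lemma osc_cut:
  assumes A: "2 * R \<le> A" "R + d \<le> A" "L \<le> A" and u: "0 \<le> u" "u < v"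
  shows "osc_le (\<lambda>x. g (F x) - g (min (F x) A)) (153 * e) u v"
proof -
  have scA: "scale A = A - R" "A \<le> 2 * scale A" "scale A \<le> A" "d \<le> A" "0 < A"
    using A R d by (auto simp: scale_def)
  let ?k = "\<lambda>x. g (F x) - g (min (F x) A)"
  have li_min: "loc_integrable (\<lambda>x. g (min (F x) A))"
    by (rule loc_integrable_comp_F[of "\<lambda>y. g (min y A)"], rule continuous_on_compose2[OF continuous_on_g])
      (use scA in \<open>auto intro!: continuous_intros\<close>)
  then have li: "loc_integrable ?k" using loc_integrable_g by auto
  consider "v \<le> A" | "A \<le> u" | "u < A" "A < v" "v \<le> A + scale A" | "u < A" "A + scale A < v" by linarith
  then show ?thesis
  proof cases
    case 1
    then show ?thesis using u e by (intro osc_le_bounded[of _ _ _ 0] li) (auto simp: mem_J_iff)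
  next
    case 2
    \<comment> \<open>Beyond \<open>A\<close> only a constant is subtracted, so it is enough to
      write \<open>g\<close> as \<open>f\<close> minus \<open>f - g\<close>.\<close>
    have "osc_le f e u v"
      using u 2 A R d osc_far[of u v] by (intro osc_leI) auto
    then have "osc_le (\<lambda>x. f x - (f x - g (F x))) (e + 18 * e) u v"
      using u f loc_integrable_g by (intro osc_le_diff osc_f_minus_g) auto
    then obtain c where c: "N (\<lambda>x. g (F x) - c) u v \<le> 19 * e * (v - u)" by (auto simp: osc_le_def)
    have "N (\<lambda>x. ?k x - (c - g A)) u v = N (\<lambda>x. g (F x) - c) u v"
      using 2 u by (intro N_cong) (auto simp: mem_J_iff min_def)
    also have "\<dots> \<le> 19 * e * (v - u)" by (rule c)
    also have "\<dots> \<le> 153 * e * (v - u)" using e u by (intro mult_right_mono) auto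
    finally show ?thesis by (rule osc_leI)
  next
    case 3
    have "norm (?k x) \<le> 6 * e" if "x \<in> J u v" for x
      using that 3 u e g_near[of A "F x"] scA by (auto simp: mem_J_iff min_def)
    then have "N (\<lambda>x. ?k x - 0) u v \<le> 6 * e * (v - u)"
      using u e li by (intro N_le_bound) auto
    also have "\<dots> \<le> 153 * e * (v - u)" using e u by (intro mult_right_mono) auto
    finally show ?thesis by (rule osc_leI)
  next
    case 4
    \<comment> \<open>The interval is enlarged to \<open>J 0 v\<close>, whose length is at least
      \<open>L\<close>, so that \<open>osc_large\<close> applies.\<close>
    define c where "c = avg lam f (J 0 v)"
    have v: "A < v" "0 < v" using 4 scA by auto
    have "N (\<lambda>x. f x - c) 0 v \<le> e * (v - 0)"
      unfolding c_def using v A by (intro osc_large) auto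
    moreover have "N (\<lambda>x. f x - g (F x)) 0 v \<le> 6 * e * (v - 0 + scale v)"
      using v by (intro N_f_minus_g) auto
    moreover have "6 * e * (v - 0 + scale v) \<le> 6 * e * (2 * v)"
      using v scA R e by (intro mult_left_mono) (auto simp: scale_def)
    moreover have "N (\<lambda>x. g (F x) - c) 0 v \<le> N (\<lambda>x. g (F x) - f x) 0 v + N (\<lambda>x. f x - c) 0 v"
      using v by (intro N_triangle_diff f loc_integrable_g) auto
    ultimately have gc: "N (\<lambda>x. g (F x) - c) 0 v \<le> 13 * e * v"
      using N_minus[of f "\<lambda>x. g (F x)"] by simp
    \<comment> \<open>\<open>g A\<close> is close to \<open>g\<close> on its window, and
      \<open>g\<close> is close to \<open>c\<close> in mean there. Doubling 6 + 13 = 19 passes from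
      \<open>scale A\<close> to \<open>A\<close>.\<close>
    have gA: "A * norm (g A - c) \<le> 38 * e * v"
    proof -
      have "scale A * norm (g A - c) = N (\<lambda>x. g A - c) A (A + scale A)"
        using scA scale_pos[of A] by (subst N_const) auto
      also have "\<dots> \<le> N (\<lambda>x. g A - g (F x)) A (A + scale A) + N (\<lambda>x. g (F x) - c) A (A + scale A)"
        using scA scale_pos[of A] loc_integrable_g by (intro N_triangle_diff) auto
      also have "\<dots> \<le> 6 * e * (A + scale A - A) + 13 * e * v"
      proof (rule add_mono)
        have "norm (g A - g (F x)) \<le> 6 * e" if "x \<in> J A (A + scale A)" for x
          using that scA scale_pos[of A] g_near[of A "F x"] by (simp add: mem_J_iff norm_minus_commute)
        then show "N (\<lambda>x. g A - g (F x)) A (A + scale A) \<le> 6 * e * (A + scale A - A)"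
          using scA scale_pos[of A] e loc_integrable_g by (intro N_le_bound) auto
        have "N (\<lambda>x. g (F x) - c) A (A + scale A) \<le> N (\<lambda>x. g (F x) - c) 0 v"
          using scA scale_pos[of A] 4 loc_integrable_g by (intro N_mono_interval) auto
        with gc show "N (\<lambda>x. g (F x) - c) A (A + scale A) \<le> 13 * e * v" by linarith
      qed
      also have "\<dots> \<le> 6 * e * v + 13 * e * v"
        using scA v e by (intro add_mono mult_left_mono) auto
      finally have "2 * (scale A * norm (g A - c)) \<le> 38 * e * v" by simp
      moreover have "A * norm (g A - c) \<le> 2 * scale A * norm (g A - c)"
        using scA by (intro mult_right_mono) auto
      ultimately show ?thesis by linarith
    qed
    \<comment> \<open>This shift makes the function equal to the constant \<open>g A - c\<close>
      before \<open>A\<close> and to \<open>g (F x) - c\<close> after it, with costs 38 and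
      13.\<close>
    let ?h = "\<lambda>x. ?k x - (c - g A)"
    have lih: "loc_integrable ?h" using li by auto
    have "N ?h u v \<le> N ?h 0 v"
      using u by (intro N_mono_interval[OF lih]) auto
    also have "\<dots> = N ?h 0 A + N ?h A v"
      using scA v by (intro N_split[OF lih]) auto
    also have "N ?h 0 A = N (\<lambda>x. g A - c) 0 A"
      using scA by (intro N_cong) (auto simp: mem_J_iff min_def)
    also have "\<dots> = A * norm (g A - c)"
      using scA by (subst N_const) auto
    also have "N ?h A v = N (\<lambda>x. g (F x) - c) A v"
      using scA v by (intro N_cong) (auto simp: mem_J_iff min_def)
    also have "\<dots> \<le> N (\<lambda>x. g (F x) - c) 0 v"
      using scA v loc_integrable_g by (intro N_mono_interval) auto
    finally have "N ?h u v \<le> 51 * e * v" using gA gc by simp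
    also have "\<dots> \<le> 51 * e * (3 * (v - u))"
      using 4 u scA e by (intro mult_left_mono) auto
    finally show ?thesis by (intro osc_leI[of _ "c - g A"]) (simp add: algebra_simps)
  qed
qed

text \<open>The 179 is made up of 18 for averaging, 153 for freezing beyond \<open>A\<close>, 6 for
  freezing below \<open>d\<close>, and 1 each for the logarithmic cutoff and the uniform
  approximation.\<close>

lemma test_function_near:
  obtains \<phi> where "\<phi> \<in> test_functions" "\<And>u v. 0 \<le> u \<Longrightarrow> u < v \<Longrightarrow> osc_le (\<lambda>x. f x - \<phi> x) (179 * e) u v"
proof -
  define A where "A = max (2 * R) (max (R + d) L)"
  have A: "2 * R \<le> A" "R + d \<le> A" "L \<le> A" "d \<le> A" "0 < A" using R d by (auto simp: A_def)
  define h1 where "h1 y = g (min y A)" for y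
  define h2 where "h2 y = g (max d (min y A))" for y
  have cont: "continuous_on {0..} h1" "continuous_on {0..} h2"
    unfolding h1_def h2_def using A d
    by (intro continuous_on_compose2[OF continuous_on_g] continuous_intros; auto)+
  then have li_h: "loc_integrable (\<lambda>x. h1 (F x))" "loc_integrable (\<lambda>x. h2 (F x))"
    by (auto intro: loc_integrable_comp_F)
  have h12: "norm (h1 y - h2 y) \<le> 6 * e" if "0 \<le> y" for y
  proof (cases "min y A \<le> d")
    case True
    have "norm (g d - g (min y A)) \<le> 6 * e"
      using that A True scale_ge[of "min y A"] by (intro g_near) linarith+
    moreover have "max d (min y A) = d" using True by linarith
    ultimately show ?thesis by (simp only: h1_def h2_def norm_minus_commute)
  next
    case False
    then have "max d (min y A) = min y A" by linarith
    then show ?thesis using e by (simp add: h1_def h2_def)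
  qed
  define c where "c = g d - g A"
  \<comment> \<open>Chosen so that the cutoff times the jump \<open>c\<close> has oscillation at
    most \<open>e\<close>; the summand 1 keeps \<open>K\<close> positive when
    \<open>c = 0\<close>.\<close>
  define K where "K = 4 * norm c / e + 1"
  have K: "0 < K" "4 * norm c / K \<le> e"
  proof -
    show "0 < K" using e by (auto simp: K_def intro!: add_nonneg_pos)
    moreover have "4 * norm c \<le> e * K" using e by (simp add: K_def field_simps)
    ultimately show "4 * norm c / K \<le> e" by (simp add: pos_divide_le_eq)
  qed
  let ?l = "log_cutoff K d"
  define k where "k x = h2 (F x) - g A - ?l (F x) *\<^sub>R c" for x
  \<comment> \<open>Below \<open>a\<close> the cutoff is 1, and \<open>k\<close> becomes
    \<open>g d - g A - c\<close>, which is 0.\<close>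
  define a where "a = d * exp (- K)"
  have a: "0 < a" "a < d" using d K by (auto simp: a_def)
  have Ga: "0 < G a" "G a < G A" using G_strict_mono[of 0 a] G_strict_mono[of a A] a A by auto
  have k0: "k x = 0" if "0 < x" "x \<notin> {G a<..<G A}" for x
  proof -
    have y: "0 < x" "0 < F x" using that F_pos by blast+
    have "x \<notin> J a A" using that by (simp add: J_def)
    then consider "F x \<le> a" | "A \<le> F x" using y a A by (auto simp: mem_J_iff not_less)
    then show ?thesis
    proof cases
      case 1
      have "ln (d / a) \<le> ln (d / F x)"
        using 1 y a d by (subst ln_le_cancel_iff) (auto intro: divide_left_mono)
      moreover have "ln (d / a) = K" using d by (simp add: a_def exp_minus field_simps)
      ultimately have "?l (F x) = 1" using K by (simp add: log_cutoff_def pos_le_divide_eq)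
      moreover have "h2 (F x) = g d" using 1 a A by (simp add: h2_def max_def)
      ultimately show ?thesis by (simp add: k_def c_def)
    next
      case 2
      have "ln (d / F x) \<le> 0"
        using 2 y A d by (subst ln_le_zero_iff) (auto simp: divide_le_eq)
      then have "?l (F x) = 0" using K by (simp add: log_cutoff_def divide_nonpos_pos)
      moreover have "h2 (F x) = g A" using 2 A by (simp add: h2_def max_def)
      ultimately show ?thesis by (simp add: k_def)
    qed
  qed
  have cont_k: "continuous_on {0<..} k"
    unfolding k_def
    by (intro continuous_intros continuous_on_compose2[OF cont(2)] continuous_on_subset[OF continuous_on_F]
        continuous_on_compose2[OF continuous_on_log_cutoff[OF K(1) d]]) (auto simp: F_pos)
  \<comment> \<open>\<open>test_function_approx\<close> asks for zeros on the whole real line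
    outside the inner interval, so the negative side is set to 0.\<close>
  let ?k = "\<lambda>x. if 0 < x then k x else 0"
  obtain \<phi> where \<phi>: "\<phi> \<in> test_functions" "\<And>x. norm (?k x - \<phi> x) \<le> e"
  proof (rule test_function_approx[of "G a / 2" "G a" "G A" "G A + 1" ?k e])
    have "continuous_on {G a / 2..G A + 1} k"
      using Ga(1) by (intro continuous_on_subset[OF cont_k]) auto
    then show "continuous_on {G a / 2..G A + 1} ?k"
      by (rule continuous_on_eq) (use Ga(1) in auto)
  qed (use Ga e k0 in auto)
  have li_\<phi>: "loc_integrable \<phi>" using \<phi>(1) by (rule loc_integrable_test_function)
  have li_l: "loc_integrable (\<lambda>x. ?l (F x) *\<^sub>R c)" by (rule loc_integrable_log_cutoff[OF K(1) d])
  have li_k: "loc_integrable k" unfolding k_def by (intro loc_integrable_diff loc_integrable_const li_h li_l)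
  have "osc_le (\<lambda>x. f x - \<phi> x) (179 * e) u v" if u: "0 \<le> u" "u < v" for u v
  proof -
    note li = f loc_integrable_g li_h li_\<phi> li_l li_k
    have "osc_le (\<lambda>x. g (F x) - h1 (F x)) (153 * e) u v"
      unfolding h1_def using A u by (intro osc_cut)
    moreover have "osc_le (\<lambda>x. h1 (F x) - h2 (F x)) (6 * e) u v"
      using u e h12 li by (intro osc_le_bounded[of _ _ _ 0]) auto
    moreover have "osc_le (\<lambda>x. k x - \<phi> x) e u v"
    proof (rule osc_le_bounded[of _ _ _ 0])
      fix x assume "x \<in> J u v"
      then have "0 < x" using u by (auto simp: mem_J_iff)
      then show "norm (k x - \<phi> x - 0) \<le> e" using \<phi>(2)[of x] by simp
    qed (use u e li in auto)
    ultimately have "osc_le (\<lambda>x. (f x - g (F x)) + (g (F x) - h1 (F x)) + (h1 (F x) - h2 (F x))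
        + (?l (F x) *\<^sub>R c) + (k x - \<phi> x)) (18 * e + 153 * e + 6 * e + 4 * norm c / K + e) u v"
      using u li osc_f_minus_g[OF u] osc_le_log_cutoff[OF K(1) d u, of c]
      by (intro osc_le_add loc_integrable_add loc_integrable_diff) auto
    \<comment> \<open>The sum telescopes to \<open>f - \<phi>\<close> up to the constant
      \<open>g A\<close>, which does not affect oscillation.\<close>
    moreover have "(\<lambda>x. (f x - g (F x)) + (g (F x) - h1 (F x)) + (h1 (F x) - h2 (F x))
        + (?l (F x) *\<^sub>R c) + (k x - \<phi> x)) = (\<lambda>x. f x - \<phi> x - g A)"
      by (auto simp: k_def)
    ultimately have "osc_le (\<lambda>x. f x - \<phi> x - g A) (18 * e + 153 * e + 6 * e + 4 * norm c / K + e) u v"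
      by (simp only:)
    then obtain b where "N (\<lambda>x. f x - \<phi> x - g A - b) u v
        \<le> (18 * e + 153 * e + 6 * e + 4 * norm c / K + e) * (v - u)"
      unfolding osc_le_def by blast
    also have "\<dots> \<le> 179 * e * (v - u)" using K(2) u by (intro mult_right_mono) auto
    finally show ?thesis by (intro osc_leI[of _ "g A + b"]) (simp add: diff_diff_eq add.assoc)
  qed
  with \<phi>(1) show ?thesis by (rule that)
qed

end

section \<open>Necessity of the three conditions\<close>

lemma tendsto_ennreal_0I:
  fixes h :: "'b \<Rightarrow> ennreal"
  assumes "\<And>\<eta>::real. 0 < \<eta> \<Longrightarrow> eventually (\<lambda>x. h x \<le> ennreal \<eta>) net"
  shows "(h \<longlongrightarrow> 0) net"
proof (rule order_tendstoI)
  fix a :: ennreal assume "0 < a"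
  \<comment> \<open>\<open>a\<close> may be infinite; a value strictly below it is a real
    number.\<close>
  then obtain z where z: "0 < z" "z < a" using dense by blast
  then obtain \<eta> where \<eta>: "z = ennreal \<eta>" "0 \<le> \<eta>" by (cases z) auto
  have "eventually (\<lambda>x. h x \<le> ennreal \<eta>) net" using z \<eta> by (intro assms) auto
  then show "eventually (\<lambda>x. h x < a) net"
    by eventually_elim (use z \<eta> in auto)
qed simp

context half_line
begin

lemma BMO_norm_le:
  assumes "loc_integrable f" "\<And>u v. 0 \<le> u \<Longrightarrow> u < v \<Longrightarrow> osc_le f C u v"
  shows "BMO_norm lam f \<le> ennreal (2 * C)"
  unfolding BMO_norm_def using assms
  by (intro SUP_least) (auto simp: intervals_eq intro: osc_le_mean_osc_le)

text \<open>F x is a multiple of x times an increasing power of x, and the power can only grow when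
  its argument is replaced by the sum.\<close>

lemma F_superadditive:
  assumes "0 \<le> a" "0 \<le> t" shows "F a + F t \<le> F (a + t)"
proof (cases "a = 0 \<or> t = 0")
  case False
  have "a * a powr (2 * lam) + t * t powr (2 * lam)
      \<le> a * (a + t) powr (2 * lam) + t * (a + t) powr (2 * lam)"
    using assms lam by (intro add_mono mult_left_mono powr_mono2) auto
  moreover have "x powr (2 * lam + 1) = x * x powr (2 * lam)" if "0 < x" for x :: real
    using that by (simp add: powr_add)
  ultimately show ?thesis
    using assms False lam
    by (simp add: F_def add_divide_distrib[symmetric] divide_right_mono algebra_simps)
qed auto

text \<open>By superadditivity an interval of length s has mass at least \<open>F s\<close>,
  wherever it lies. Small mass therefore forces small length, which is what uniform continuity in x
  requires.\<close>

lemma G_diff_less: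
  assumes "0 \<le> u" "u \<le> v" "v - u < F s" "0 < s" shows "G v - G u < s"
proof -
  have le: "G u \<le> G v" using assms by (simp add: G_le_iff)
  then have "F (G u) + F (G v - G u) \<le> F (G u + (G v - G u))"
    by (intro F_superadditive) auto
  then have "F (G v - G u) < F s" using assms by simp
  then show ?thesis using le assms by (simp add: F_less_iff)
qed

lemma test_function_osc_small:
  assumes \<phi>: "\<phi> \<in> test_functions" and \<eta>: "0 < \<eta>"
  obtains \<delta> where "0 < \<delta>" "\<And>u v. 0 \<le> u \<Longrightarrow> u < v \<Longrightarrow> v - u < \<delta> \<Longrightarrow> osc_le \<phi> \<eta> u v"
proof -
  have "uniformly_continuous_on {0<..} \<phi>"
    using test_function_uniformly_continuous[OF \<phi>] by blast
  then obtain s where s: "0 < s"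
    "\<forall>x\<in>{0<..}. \<forall>y\<in>{0<..}. dist y x < s \<longrightarrow> dist (\<phi> y) (\<phi> x) < \<eta>"
    using \<eta> unfolding uniformly_continuous_on_def by blast
  have "osc_le \<phi> \<eta> u v" if u: "0 \<le> u" "u < v" "v - u < F s" for u v
  proof (rule osc_le_bounded[OF loc_integrable_test_function[OF \<phi>]])
    have len: "G v - G u < s" using u s by (intro G_diff_less) auto
    let ?x = "G ((u + v) / 2)"
    have x: "?x \<in> J u v" using u by (auto simp: J_def G_less_iff)
    fix y assume y: "y \<in> J u v"
    have "0 < ?x" "0 < y" using x y u by (simp_all add: mem_J_iff)
    moreover have "dist y ?x < s" using x y len by (auto simp: J_def dist_real_def abs_if)
    ultimately have "dist (\<phi> y) (\<phi> ?x) < \<eta>" using s(2) by simp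
    then show "norm (\<phi> y - \<phi> ?x) \<le> \<eta>" by (simp add: dist_norm)
  qed (use u \<eta> in auto)
  then show ?thesis using F_pos[OF s(1)] that by blast
qed

text \<open>The integral of \<open>norm (\<phi> x)\<close> over any interval is at most its total
  over \<open>J 0 (F \<beta>)\<close>, so with the constant 0 the mean decays like the inverse of
  the mass.\<close>

lemma test_function_osc_large:
  assumes \<phi>: "\<phi> \<in> test_functions" and \<eta>: "0 < \<eta>"
  obtains L where "\<And>u v. 0 \<le> u \<Longrightarrow> u < v \<Longrightarrow> L \<le> v - u \<Longrightarrow> osc_le \<phi> \<eta> u v"
proof -
  note li = loc_integrable_test_function[OF \<phi>]
  obtain \<alpha> \<beta> where ab: "0 < \<alpha>" "\<alpha> \<le> \<beta>" "\<And>x. 0 < x \<Longrightarrow> x \<notin> {\<alpha>..\<beta>} \<Longrightarrow> \<phi> x = 0"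
    "uniformly_continuous_on {0<..} \<phi>"
    using test_function_uniformly_continuous[OF \<phi>] by blast
  let ?V = "F \<beta>" and ?L = "N \<phi> 0 (F \<beta>) / \<eta>"
  have "osc_le \<phi> \<eta> u v" if u: "0 \<le> u" "u < v" "?L \<le> v - u" for u v
  proof -
    have "N \<phi> u v \<le> N \<phi> 0 (max v ?V)" using u by (intro N_mono_interval[OF li]) auto
    also have "\<dots> = N \<phi> 0 ?V + N \<phi> ?V (max v ?V)" by (intro N_split[OF li]) auto
    also have "N \<phi> ?V (max v ?V) \<le> 0 * (max v ?V - ?V)"
    proof (rule N_le_bound[OF li])
      fix x assume "x \<in> J ?V (max v ?V)"
      then have "\<beta> < x" using ab(1,2) by (simp add: J_def)
      then show "norm (\<phi> x) \<le> 0" using ab by simp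
    qed auto
    also have "N \<phi> 0 ?V + 0 * (max v ?V - ?V) \<le> \<eta> * (v - u)"
      using u(3) \<eta> by (simp add: pos_divide_le_eq mult.commute)
    finally show ?thesis by (intro osc_leI[of _ 0]) simp
  qed
  then show ?thesis by (rule that)
qed

text \<open>One quarter of \<open>\<eta>\<close> goes to the approximation and one to
  \<open>\<phi>\<close>; \<open>osc_le_mean_osc_le\<close> doubles the sum.\<close>

lemma CMO_near:
  fixes f :: "real \<Rightarrow> 'a::euclidean_space"
  assumes f: "f \<in> CMO lam" and \<eta>: "0 < \<eta>"
  obtains \<phi> :: "real \<Rightarrow> 'a" where "\<phi> \<in> test_functions"
    "\<And>u v. 0 \<le> u \<Longrightarrow> u < v \<Longrightarrow> osc_le \<phi> (\<eta> / 4) u v \<Longrightarrow> mean_osc lam f (J u v) \<le> ennreal \<eta>"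
proof -
  obtain \<phi> :: "real \<Rightarrow> 'a" where \<phi>: "\<phi> \<in> test_functions" "BMO_norm lam (\<lambda>x. f x - \<phi> x) < ennreal (\<eta> / 4)"
  proof -
    have "\<forall>\<epsilon>>0. \<exists>\<phi>\<in>test_functions. BMO_norm lam (\<lambda>x. f x - \<phi> x) < ennreal \<epsilon>"
      using f by (simp add: CMO_def)
    from this[rule_format, of "\<eta> / 4"] \<eta> show ?thesis using that by auto
  qed
  have li: "loc_integrable f" "loc_integrable \<phi>"
    using f by (auto simp: CMO_def intro: loc_integrable_of_BMO loc_integrable_test_function[OF \<phi>(1)])
  have "mean_osc lam f (J u v) \<le> ennreal \<eta>" if u: "0 \<le> u" "u < v" "osc_le \<phi> (\<eta> / 4) u v" for u v
  proof -
    have "J u v \<in> intervals" using u by (auto simp: intervals_eq)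
    then have "mean_osc lam (\<lambda>x. f x - \<phi> x) (J u v) \<le> BMO_norm lam (\<lambda>x. f x - \<phi> x)"
      unfolding BMO_norm_def by (rule SUP_upper)
    then have "osc_le (\<lambda>x. f x - \<phi> x) (\<eta> / 4) u v"
      using u \<eta> li \<phi>(2) by (intro mean_osc_le_osc_le) auto
    then have "osc_le (\<lambda>x. f x - \<phi> x + \<phi> x) (\<eta> / 4 + \<eta> / 4) u v"
      using u li by (intro osc_le_add) auto
    then show ?thesis using osc_le_mean_osc_le[OF li(1) u(1,2), of "\<eta> / 4 + \<eta> / 4"] by simp
  qed
  with \<phi>(1) show ?thesis by (rule that)
qed

lemma CMO_imp_limits:
  fixes f :: "real \<Rightarrow> 'a::euclidean_space"
  assumes f: "f \<in> CMO lam"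
  shows "((\<lambda>a. SUP I\<in>{I \<in> intervals. measure M I = a}. mean_osc lam f I) \<longlongrightarrow> 0) (at_right 0)" (is ?A)
    and "((\<lambda>a. SUP I\<in>{I \<in> intervals. measure M I = a}. mean_osc lam f I) \<longlongrightarrow> 0) at_top" (is ?B)
    and "((\<lambda>R::real. SUP I\<in>{I \<in> intervals. I \<subseteq> {R..}}. mean_osc lam f I) \<longlongrightarrow> 0) at_top" (is ?C)
proof -
  show ?A
  proof (rule tendsto_ennreal_0I)
    fix \<eta> :: real assume \<eta>: "0 < \<eta>"
    obtain \<phi> :: "real \<Rightarrow> 'a" where \<phi>: "\<phi> \<in> test_functions"
      "\<And>u v. 0 \<le> u \<Longrightarrow> u < v \<Longrightarrow> osc_le \<phi> (\<eta> / 4) u v \<Longrightarrow> mean_osc lam f (J u v) \<le> ennreal \<eta>"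
      using CMO_near[OF f \<eta>] by blast
    obtain \<delta> where \<delta>: "0 < \<delta>" "\<And>u v. 0 \<le> u \<Longrightarrow> u < v \<Longrightarrow> v - u < \<delta> \<Longrightarrow> osc_le \<phi> (\<eta> / 4) u v"
      using test_function_osc_small[OF \<phi>(1), of "\<eta> / 4"] \<eta> by auto
    show "eventually (\<lambda>a. (SUP I\<in>{I \<in> intervals. measure M I = a}. mean_osc lam f I) \<le> ennreal \<eta>) (at_right 0)"
      using eventually_at_right_real[OF \<delta>(1)]
    proof eventually_elim
      case (elim a)
      then show ?case
        by (intro SUP_least) (auto simp: intervals_eq measure_J intro!: \<phi>(2) \<delta>(2))
    qed
  qed
  show ?B
  proof (rule tendsto_ennreal_0I)
    fix \<eta> :: real assume \<eta>: "0 < \<eta>"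
    obtain \<phi> :: "real \<Rightarrow> 'a" where \<phi>: "\<phi> \<in> test_functions"
      "\<And>u v. 0 \<le> u \<Longrightarrow> u < v \<Longrightarrow> osc_le \<phi> (\<eta> / 4) u v \<Longrightarrow> mean_osc lam f (J u v) \<le> ennreal \<eta>"
      using CMO_near[OF f \<eta>] by blast
    obtain L where L: "\<And>u v. 0 \<le> u \<Longrightarrow> u < v \<Longrightarrow> L \<le> v - u \<Longrightarrow> osc_le \<phi> (\<eta> / 4) u v"
      using test_function_osc_large[OF \<phi>(1), of "\<eta> / 4"] \<eta> by auto
    show "eventually (\<lambda>a. (SUP I\<in>{I \<in> intervals. measure M I = a}. mean_osc lam f I) \<le> ennreal \<eta>) at_top"
      using eventually_ge_at_top[of L]
    proof eventually_elim
      case (elim a)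
      then show ?case
        by (intro SUP_least) (auto simp: intervals_eq measure_J intro!: \<phi>(2) L)
    qed
  qed
  show ?C
  proof (rule tendsto_ennreal_0I)
    fix \<eta> :: real assume \<eta>: "0 < \<eta>"
    obtain \<phi> :: "real \<Rightarrow> 'a" where \<phi>: "\<phi> \<in> test_functions"
      "\<And>u v. 0 \<le> u \<Longrightarrow> u < v \<Longrightarrow> osc_le \<phi> (\<eta> / 4) u v \<Longrightarrow> mean_osc lam f (J u v) \<le> ennreal \<eta>"
      using CMO_near[OF f \<eta>] by blast
    obtain \<alpha> \<beta> where ab: "0 < \<alpha>" "\<alpha> \<le> \<beta>" "\<And>x. 0 < x \<Longrightarrow> x \<notin> {\<alpha>..\<beta>} \<Longrightarrow> \<phi> x = 0"
      "uniformly_continuous_on {0<..} \<phi>"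
      using test_function_uniformly_continuous[OF \<phi>(1)] by blast
    \<comment> \<open>Beyond \<open>\<beta>\<close> the test function vanishes, so its oscillation
      is 0 there.\<close>
    show "eventually (\<lambda>R. (SUP I\<in>{I \<in> intervals. I \<subseteq> {R..}}. mean_osc lam f I) \<le> ennreal \<eta>) at_top"
      using eventually_gt_at_top[of \<beta>]
    proof eventually_elim
      case (elim R)
      show ?case
      proof (rule SUP_least)
        fix I assume "I \<in> {I \<in> intervals. I \<subseteq> {R..}}"
        then obtain u v where u: "I = J u v" "0 \<le> u" "u < v" "J u v \<subseteq> {R..}"
          by (auto simp: intervals_eq)
        have "\<phi> x = 0" if "x \<in> J u v" for x
          using that u elim ab(1,2) by (intro ab(3)) auto
        then have "osc_le \<phi> (\<eta> / 4) u v"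
          using u \<eta> loc_integrable_test_function[OF \<phi>(1)] by (intro osc_le_bounded[of _ _ _ 0]) auto
        then show "mean_osc lam f I \<le> ennreal \<eta>" using u \<phi>(2) by simp
      qed
    qed
  qed
qed

section \<open>Sufficiency of the three conditions\<close>

lemma limits_imp_CMO:
  fixes f :: "real \<Rightarrow> 'a::euclidean_space"
  assumes f: "f \<in> BMO lam"
    and A: "((\<lambda>a. SUP I\<in>{I \<in> intervals. measure M I = a}. mean_osc lam f I) \<longlongrightarrow> 0) (at_right 0)"
    and B: "((\<lambda>a. SUP I\<in>{I \<in> intervals. measure M I = a}. mean_osc lam f I) \<longlongrightarrow> 0) at_top"
    and C: "((\<lambda>R::real. SUP I\<in>{I \<in> intervals. I \<subseteq> {R..}}. mean_osc lam f I) \<longlongrightarrow> 0) at_top"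
  shows "f \<in> CMO lam"
  unfolding CMO_def
proof (intro CollectI conjI allI impI f)
  fix \<eta> :: real assume \<eta>: "0 < \<eta>"
  \<comment> \<open>The final bound is 2 * 179 = 358 times \<open>e\<close>, which stays below
    \<open>\<eta>\<close>.\<close>
  define e where "e = \<eta> / 400"
  have e: "0 < e" "0 < ennreal e" using \<eta> by (simp_all add: e_def)
  note li = loc_integrable_of_BMO[OF f]
  obtain d where d: "0 < d" "\<And>a. 0 < a \<Longrightarrow> a < d \<Longrightarrow>
      (SUP I\<in>{I \<in> intervals. measure M I = a}. mean_osc lam f I) < ennreal e"
    using order_tendstoD(2)[OF A e(2)] unfolding eventually_at_right_field by blast
  obtain L where L: "\<And>a. L \<le> a \<Longrightarrow>
      (SUP I\<in>{I \<in> intervals. measure M I = a}. mean_osc lam f I) < ennreal e"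
    using order_tendstoD(2)[OF B e(2)] unfolding eventually_at_top_linorder by blast
  obtain R where R: "\<And>r. R \<le> r \<Longrightarrow>
      (SUP I\<in>{I \<in> intervals. I \<subseteq> {r..}}. mean_osc lam f I) < ennreal e"
    using order_tendstoD(2)[OF C e(2)] unfolding eventually_at_top_linorder by blast
  have N_le: "N (\<lambda>x. f x - avg lam f (J u v)) u v \<le> e * (v - u)"
    if u: "0 \<le> u" "u < v" and S: "J u v \<in> S" "(SUP I\<in>S. mean_osc lam f I) < ennreal e" for u v S
  proof -
    have "mean_osc lam f (J u v) \<le> (SUP I\<in>S. mean_osc lam f I)" using S(1) by (rule SUP_upper)
    then show ?thesis using S(2) e by (intro mean_osc_le_imp[OF li u]) auto
  qed
  have size: "J u v \<in> {I \<in> intervals. measure M I = v - u}" if "0 \<le> u" "u < v" for u v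
    using that by (auto simp: intervals_eq measure_J)
  \<comment> \<open>Three times \<open>d / 4\<close> stays strictly below \<open>d\<close>. The
    threshold \<open>R\<close> of the third condition is a position in x that might be negative;
    \<open>F (max R 0)\<close> is its coordinate.\<close>
  interpret small_osc lam f e "d / 4" "F (max R 0)" L
  proof
    fix u v :: real assume u: "0 \<le> u" "u < v"
    show "N (\<lambda>x. f x - avg lam f (J u v)) u v \<le> e * (v - u)" if "v - u \<le> 3 * (d / 4)"
      using that u d(1) by (intro N_le[OF u size[OF u]] d(2)) auto
    show "N (\<lambda>x. f x - avg lam f (J u v)) u v \<le> e * (v - u)" if "L \<le> v - u"
      using that by (intro N_le[OF u size[OF u]] L)
  next
    fix u v :: real assume u: "F (max R 0) \<le> u" "u < v"
    then have u0: "0 \<le> u" using F_nonneg order_trans by blast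
    have Gu: "max R 0 \<le> G u" using u u0 G_le_iff[of "F (max R 0)" u] by simp
    have "J u v \<subseteq> {max R 0..}"
    proof
      fix x assume "x \<in> J u v"
      then have "G u \<le> x" by (simp add: J_def)
      with Gu show "x \<in> {max R 0..}" by (simp only: atLeast_iff order_trans[OF Gu])
    qed
    then have "J u v \<in> {I \<in> intervals. I \<subseteq> {max R 0..}}"
      using u u0 by (auto simp: intervals_eq)
    then show "N (\<lambda>x. f x - avg lam f (J u v)) u v \<le> e * (v - u)"
      by (rule N_le[OF u0 u(2)]) (rule R, simp)
  qed (use li e d in auto)
  obtain \<phi> where \<phi>: "\<phi> \<in> test_functions"
    "\<And>u v. 0 \<le> u \<Longrightarrow> u < v \<Longrightarrow> osc_le (\<lambda>x. f x - \<phi> x) (179 * e) u v"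
    using test_function_near by blast
  have "BMO_norm lam (\<lambda>x. f x - \<phi> x) \<le> ennreal (2 * (179 * e))"
    using li loc_integrable_test_function[OF \<phi>(1)] \<phi>(2) by (intro BMO_norm_le) auto
  also have "\<dots> < ennreal \<eta>" using \<eta> by (intro ennreal_lessI) (auto simp: e_def)
  finally show "\<exists>\<phi>\<in>test_functions. BMO_norm lam (\<lambda>x. f x - \<phi> x) < ennreal \<eta>"
    using \<phi>(1) by blast
qed

end

theorem theorem3p1:
  fixes lam :: real
    and f :: "real \<Rightarrow> 'a::{real_normed_field, euclidean_space}"
  assumes "lam > 0"
    and "f \<in> BMO lam"
  shows "f \<in> CMO lam \<longleftrightarrow>
    ((\<lambda>a. SUP I\<in>{I \<in> intervals. measure (m_lam lam) I = a}. mean_osc lam f I) \<longlongrightarrow> 0) (at_right 0)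
  \<and> ((\<lambda>a. SUP I\<in>{I \<in> intervals. measure (m_lam lam) I = a}. mean_osc lam f I) \<longlongrightarrow> 0) at_top
  \<and> ((\<lambda>R::real. SUP I\<in>{I \<in> intervals. I \<subseteq> {R..}}. mean_osc lam f I) \<longlongrightarrow> 0) at_top"
proof -
  interpret half_line lam by unfold_locales (rule assms(1))
  show ?thesis
    using CMO_imp_limits[of f] limits_imp_CMO[OF assms(2)] by blast
qed

end
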